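(* Let $n\ge 1$, $\lambda\in\mathbb{R}^*=\mathbb{R}\setminus\{0\}$, and let $T:(L^1(\mathbb{C}^n),*_\lambda)\to\mathcal{B}(L^2(\mathbb{R}^n))$ be a nonzero continuous $*$-homomorphism; that is, $T$ is a nonzero continuous linear map with $T(f*_\lambda g)=T(f)\,T(g)$ and $T(f^* )=T(f)^*$ for all $f,g\in L^1(\mathbb{C}^n)$. Then there are a subspace $\mathcal{H}^\lambda$ of $L^2(\mathbb{R}^n)$ and a unitary representation $\rho_\lambda$ of $\mathbb{H}^n$ on $\mathcal{H}^\lambda$ such that, for all $f\in L^1(\mathbb{C}^n)$, $$T(f)=\int_{\mathbb{C}^n} f(z)\,\rho_\lambda(z,0)\,dz\quad\text{on }\mathcal{H}^\lambda,$$ and there is a decomposition $L^2(\mathbb{R}^n)=\mathcal{H}^\lambda\oplus V^\lambda$, where $$V^\lambda:=\{v\in L^2(\mathbb{R}^n): (Tf)(v)=0\ \text{for all } f\in L^1(\mathbb{C}^n)\}.$$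
   Context: The Heisenberg group $\mathbb{H}^n$ is $\mathbb{C}^n\times\mathbb{R}$ with product $(z,t)(w,s)=\left(z+w,\,t+s+\tfrac12\operatorname{Im}(z\cdot\overline{w})\right)$. $\mathcal{B}(L^2(\mathbb{R}^n))$ is the algebra of bounded operators on $L^2(\mathbb{R}^n)$ with the operator norm. The $\lambda$-twisted convolution of $f,g\in L^1(\mathbb{C}^n)$ is $$(f*_\lambda g)(z)=\int_{\mathbb{C}^n} f(z-w)\,g(w)\,e^{i\frac{\lambda}{2}\operatorname{Im}(z\cdot\overline{w})}\,dw,$$ and the involution is $f^*(z)=\overline{f(-z)}$. Operator-valued integrals are understood in the weak sense. Subspaces carrying unitary representations are closed (Hilbert) subspaces, unitary representations are strongly continuous, and $\oplus$ is the orthogonal direct sum. *)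

theory Defs
  imports "HOL-Analysis.Analysis" "HOL-Algebra.Group"
begin

section \<open>Complex normed and inner product spaces\<close>

class complex_vector = real_vector +
  fixes scaleC :: "complex \<Rightarrow> 'a \<Rightarrow> 'a"  (infixr \<open>*\<^sub>C\<close> 75)
  assumes scaleC_add_right: "a *\<^sub>C (x + y) = a *\<^sub>C x + a *\<^sub>C y"
    and scaleC_add_left: "(a + b) *\<^sub>C x = a *\<^sub>C x + b *\<^sub>C x"
    and scaleC_scaleC: "a *\<^sub>C b *\<^sub>C x = (a * b) *\<^sub>C x"
    and scaleC_of_real: "complex_of_real r *\<^sub>C x = r *\<^sub>R x"

class complex_normed_vector = complex_vector + real_normed_vector +
  assumes norm_scaleC: "norm (a *\<^sub>C x) = cmod a * norm x"

text \<open>The inner product is linear in the first and antilinear in the second argument;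
  norm, topology and real inner product are those of the underlying real inner product space.\<close>

class complex_inner = complex_vector + real_inner +
  fixes cinner :: "'a \<Rightarrow> 'a \<Rightarrow> complex"
  assumes cinner_commute: "cinner x y = cnj (cinner y x)"
    and cinner_add_left: "cinner (x + y) z = cinner x z + cinner y z"
    and cinner_scaleC_left: "cinner (a *\<^sub>C x) y = a * cinner x y"
    and inner_eq_Re_cinner: "inner x y = Re (cinner x y)"
begin

lemma cinner_scaleC_right: "cinner x (a *\<^sub>C y) = cnj a * cinner x y"
  by (metis cinner_commute cinner_scaleC_left complex_cnj_mult)

lemma cinner_self: "cinner x x = complex_of_real ((norm x)\<^sup>2)"
proof -
  have "Im (cinner x x) = 0"
    by (metis Reals_cnj_iff cinner_commute complex_is_Real_iff)
  then show ?thesis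
    by (simp add: complex_eq_iff norm_eq_sqrt_inner inner_eq_Re_cinner[symmetric])
qed

subclass complex_normed_vector
proof
  fix a :: complex and x :: 'a
  have "complex_of_real ((norm (a *\<^sub>C x))\<^sup>2) = a * cnj a * complex_of_real ((norm x)\<^sup>2)"
    unfolding cinner_self[symmetric] by (simp add: cinner_scaleC_left cinner_scaleC_right)
  also have "\<dots> = complex_of_real ((cmod a * norm x)\<^sup>2)"
    unfolding power_mult_distrib of_real_mult complex_norm_square by simp
  finally have "(norm (a *\<^sub>C x))\<^sup>2 = (cmod a * norm x)\<^sup>2"
    by (simp only: of_real_eq_iff)
  then show "norm (a *\<^sub>C x) = cmod a * norm x"
    by (simp add: power2_eq_iff_nonneg norm_ge_zero)
qed

end

definition clinear_map :: "('a::complex_vector \<Rightarrow> 'b::complex_vector) \<Rightarrow> bool" where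
  "clinear_map F \<longleftrightarrow> (\<forall>x y. F (x + y) = F x + F y) \<and> (\<forall>a x. F (a *\<^sub>C x) = a *\<^sub>C F x)"

definition closed_csubspace :: "'a::complex_normed_vector set \<Rightarrow> bool" where
  "closed_csubspace S \<longleftrightarrow> 0 \<in> S \<and> (\<forall>x\<in>S. \<forall>y\<in>S. x + y \<in> S) \<and> (\<forall>a. \<forall>x\<in>S. a *\<^sub>C x \<in> S) \<and> closed S"

definition orthogonal_direct_sum :: "'a::complex_inner set \<Rightarrow> 'a set \<Rightarrow> bool" where
  "orthogonal_direct_sum S V \<longleftrightarrow>
    closed_csubspace S \<and> closed_csubspace V \<and>
    (\<forall>x\<in>S. \<forall>y\<in>V. cinner x y = 0) \<and> (\<forall>u. \<exists>x\<in>S. \<exists>y\<in>V. u = x + y)"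

section \<open>Bounded operators\<close>

instantiation blinfun :: (real_normed_vector, complex_normed_vector) complex_normed_vector
begin

lift_definition scaleC_blinfun :: "complex \<Rightarrow> 'a \<Rightarrow>\<^sub>L 'b \<Rightarrow> 'a \<Rightarrow>\<^sub>L 'b" is "\<lambda>a F x. a *\<^sub>C F x"
proof -
  fix a :: complex and F :: "'a \<Rightarrow> 'b"
  assume F: "bounded_linear F"
  have "bounded_linear (\<lambda>x::'b. a *\<^sub>C x)"
  proof (rule bounded_linear_intro[where K = "cmod a"])
    fix r and x :: 'b
    show "a *\<^sub>C r *\<^sub>R x = r *\<^sub>R a *\<^sub>C x"
      by (simp flip: scaleC_of_real add: scaleC_scaleC mult.commute)
  qed (simp_all add: scaleC_add_right norm_scaleC mult.commute)
  from bounded_linear_compose[OF this F] show "bounded_linear (\<lambda>x. a *\<^sub>C F x)" .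
qed

instance
proof
  fix a b :: complex and r :: real and F G :: "'a \<Rightarrow>\<^sub>L 'b"
  show "a *\<^sub>C (F + G) = a *\<^sub>C F + a *\<^sub>C G" by transfer (simp add: scaleC_add_right)
  show "(a + b) *\<^sub>C F = a *\<^sub>C F + b *\<^sub>C F" by transfer (simp add: scaleC_add_left)
  show "a *\<^sub>C b *\<^sub>C F = (a * b) *\<^sub>C F" by transfer (simp add: scaleC_scaleC)
  show "complex_of_real r *\<^sub>C F = r *\<^sub>R F" by transfer (simp add: scaleC_of_real)
  have le: "norm (c *\<^sub>C H) \<le> cmod c * norm H" for c and H :: "'a \<Rightarrow>\<^sub>L 'b"
  proof (rule norm_blinfun_bound)
    fix x
    have "norm (blinfun_apply H x) \<le> norm H * norm x" by (rule norm_blinfun)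
    then show "norm (blinfun_apply (c *\<^sub>C H) x) \<le> cmod c * norm H * norm x"
      by (simp add: scaleC_blinfun.rep_eq norm_scaleC mult.assoc mult_left_mono)
  qed simp
  show "norm (a *\<^sub>C F) = cmod a * norm F"
  proof (cases "a = 0")
    case True
    then show ?thesis using le[of a F] by simp
  next
    case False
    have "inverse a *\<^sub>C a *\<^sub>C F = F"
      using False by transfer (simp add: scaleC_scaleC scaleC_of_real[of 1, simplified])
    then have "norm F \<le> cmod (inverse a) * norm (a *\<^sub>C F)" using le[of "inverse a" "a *\<^sub>C F"] by simp
    then have "cmod a * norm F \<le> norm (a *\<^sub>C F)"
      using False by (simp add: norm_inverse norm_divide field_simps)
    with le[of a F] show ?thesis by simp
  qed
qed

end

text \<open>The algebra of bounded operators: the complex-linear elements of the Banach space of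
  bounded real-linear maps.  The operator norm is the same, and the product
  is \<^term>\<open>(o\<^sub>L)\<close>.\<close>

definition bounded_operators :: "('a::complex_normed_vector \<Rightarrow>\<^sub>L 'a) set" where
  "bounded_operators = {A. clinear_map (blinfun_apply A)}"

definition is_adjoint :: "('a::complex_inner \<Rightarrow>\<^sub>L 'a) \<Rightarrow> ('a \<Rightarrow>\<^sub>L 'a) \<Rightarrow> bool" where
  "is_adjoint B A \<longleftrightarrow> (\<forall>x y. cinner (A x) y = cinner x (B y))"

text \<open>\<open>A = \<integral> F d\<mu>\<close> weakly, as operators on the closed subspace \<open>S\<close>.\<close>

definition has_weak_operator_integral ::
    "'m measure \<Rightarrow> 'a::complex_inner set \<Rightarrow> ('m \<Rightarrow> 'a \<Rightarrow> 'a) \<Rightarrow> ('a \<Rightarrow> 'a) \<Rightarrow> bool" where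
  "has_weak_operator_integral \<mu> S F A \<longleftrightarrow>
    (\<forall>u\<in>S. A u \<in> S) \<and>
    (\<forall>u\<in>S. \<forall>v\<in>S. has_bochner_integral \<mu> (\<lambda>z. cinner (F z u) v) (cinner (A u) v))"

section \<open>Unitary representations\<close>

definition unitary_on :: "'a::complex_inner set \<Rightarrow> ('a \<Rightarrow> 'a) \<Rightarrow> bool" where
  "unitary_on S U \<longleftrightarrow>
    (\<forall>x\<in>S. \<forall>y\<in>S. U (x + y) = U x + U y) \<and> (\<forall>a. \<forall>x\<in>S. U (a *\<^sub>C x) = a *\<^sub>C U x) \<and>
    (\<forall>x\<in>S. \<forall>y\<in>S. cinner (U x) (U y) = cinner x y) \<and> U ` S = S"

definition unitary_representation ::
    "('g::topological_space) monoid \<Rightarrow> 'a::complex_inner set \<Rightarrow> ('g \<Rightarrow> 'a \<Rightarrow> 'a) \<Rightarrow> bool" where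
  "unitary_representation G S \<rho> \<longleftrightarrow>
    closed_csubspace S \<and>
    (\<forall>g\<in>carrier G. unitary_on S (\<rho> g)) \<and>
    (\<forall>g\<in>carrier G. \<forall>h\<in>carrier G. \<forall>v\<in>S. \<rho> (g \<otimes>\<^bsub>G\<^esub> h) v = \<rho> g (\<rho> h v)) \<and>
    (\<forall>v\<in>S. continuous_on (carrier G) (\<lambda>g. \<rho> g v))"

section \<open>The Heisenberg group\<close>

definition hdot :: "complex ^ 'n \<Rightarrow> complex ^ 'n \<Rightarrow> complex" where
  "hdot z w = (\<Sum>j\<in>UNIV. z $ j * cnj (w $ j))"

definition heisenberg :: "((complex ^ 'n) \<times> real) monoid" where
  "heisenberg =
    \<lparr>carrier = UNIV,
     mult = (\<lambda>(z, t) (w, s). (z + w, t + s + 1/2 * Im (hdot z w))),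
     one = (0, 0)\<rparr>"

lemma hdot_add_left: "hdot (x + y) z = hdot x z + hdot y z"
  by (simp add: hdot_def sum.distrib distrib_right)

lemma hdot_add_right: "hdot x (y + z) = hdot x y + hdot x z"
  by (simp add: hdot_def sum.distrib distrib_left)

lemma Im_hdot_minus_self: "Im (hdot (- z) z) = 0"
  by (simp add: hdot_def)

lemma group_heisenberg: "group (heisenberg :: ((complex ^ 'n) \<times> real) monoid)"
proof (rule groupI)
  fix x :: "(complex ^ 'n) \<times> real"
  obtain z t where x: "x = (z, t)" by force
  show "\<exists>y\<in>carrier heisenberg. y \<otimes>\<^bsub>heisenberg\<^esub> x = \<one>\<^bsub>heisenberg\<^esub>"
    by (rule bexI[of _ "(- z, - t)"]) (auto simp: heisenberg_def x Im_hdot_minus_self)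
qed (auto simp: heisenberg_def hdot_add_left hdot_add_right hdot_def[of 0] algebra_simps add_divide_distrib)

section \<open>The spaces \<open>L\<^sup>1\<close> and \<open>L\<^sup>2\<close>\<close>

text \<open>Classes of Borel functions modulo equality almost everywhere.  Every Lebesgue measurable
  function agrees almost everywhere with a Borel one, so these are the usual spaces.\<close>

definition L1_rel :: "('a::euclidean_space \<Rightarrow> complex) \<Rightarrow> ('a \<Rightarrow> complex) \<Rightarrow> bool" where
  "L1_rel f g \<longleftrightarrow> integrable lborel f \<and> integrable lborel g \<and> (AE x in lborel. f x = g x)"

quotient_type (overloaded) 'a L1 = "'a::euclidean_space \<Rightarrow> complex" / partial: L1_rel
  morphisms rep_L1 L1
proof (rule part_equivpI)
  show "\<exists>f. L1_rel f f" by (rule exI[of _ "\<lambda>_. 0"]) (simp add: L1_rel_def)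
  show "symp L1_rel" by (rule sympI) (auto simp: L1_rel_def elim: AE_mp)
  show "transp L1_rel" by (rule transpI) (auto simp: L1_rel_def elim: AE_mp)
qed

definition sq_integrable :: "('a::euclidean_space \<Rightarrow> complex) \<Rightarrow> bool" where
  "sq_integrable f \<longleftrightarrow> f \<in> borel_measurable lborel \<and> integrable lborel (\<lambda>x. (cmod (f x))\<^sup>2)"

definition L2_rel :: "('a::euclidean_space \<Rightarrow> complex) \<Rightarrow> ('a \<Rightarrow> complex) \<Rightarrow> bool" where
  "L2_rel f g \<longleftrightarrow> sq_integrable f \<and> sq_integrable g \<and> (AE x in lborel. f x = g x)"

quotient_type (overloaded) 'a L2 = "'a::euclidean_space \<Rightarrow> complex" / partial: L2_rel
  morphisms rep_L2 L2
proof (rule part_equivpI)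
  show "\<exists>f. L2_rel f f" by (rule exI[of _ "\<lambda>_. 0"]) (simp add: L2_rel_def sq_integrable_def)
  show "symp L2_rel" by (rule sympI) (auto simp: L2_rel_def elim: AE_mp)
  show "transp L2_rel" by (rule transpI) (auto simp: L2_rel_def elim: AE_mp)
qed

instantiation L1 :: (euclidean_space) complex_normed_vector
begin

lift_definition zero_L1 :: "'a L1" is "\<lambda>_. 0" by (simp add: L1_rel_def)
lift_definition plus_L1 :: "'a L1 \<Rightarrow> 'a L1 \<Rightarrow> 'a L1" is "\<lambda>f g x. f x + g x"
  by (auto simp: L1_rel_def elim!: AE_mp)
lift_definition minus_L1 :: "'a L1 \<Rightarrow> 'a L1 \<Rightarrow> 'a L1" is "\<lambda>f g x. f x - g x"
  by (auto simp: L1_rel_def elim!: AE_mp)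
lift_definition uminus_L1 :: "'a L1 \<Rightarrow> 'a L1" is "\<lambda>f x. - f x"
  by (auto simp: L1_rel_def)
lift_definition scaleR_L1 :: "real \<Rightarrow> 'a L1 \<Rightarrow> 'a L1" is "\<lambda>r f x. r *\<^sub>R f x"
  by (auto simp: L1_rel_def)
lift_definition scaleC_L1 :: "complex \<Rightarrow> 'a L1 \<Rightarrow> 'a L1" is "\<lambda>a f x. a * f x"
  by (auto simp: L1_rel_def)
lift_definition norm_L1 :: "'a L1 \<Rightarrow> real" is "\<lambda>f. \<integral>x. cmod (f x) \<partial>lborel"
  by (rule integral_cong_AE) (auto simp: L1_rel_def)

definition dist_L1 :: "'a L1 \<Rightarrow> 'a L1 \<Rightarrow> real" where "dist_L1 f g = norm (f - g)"
definition sgn_L1 :: "'a L1 \<Rightarrow> 'a L1" where "sgn_L1 f = inverse (norm f) *\<^sub>R f"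
definition uniformity_L1 :: "('a L1 \<times> 'a L1) filter" where
  "uniformity_L1 = (INF e\<in>{0<..}. principal {(f, g). dist f g < e})"
definition open_L1 :: "'a L1 set \<Rightarrow> bool" where
  "open_L1 S = (\<forall>x\<in>S. \<forall>\<^sub>F (x', y) in uniformity. x' = x \<longrightarrow> y \<in> S)"

instance
proof
  fix f g h :: "'a L1" and a b :: complex and r s :: real and S :: "'a L1 set"
  show "f + g + h = f + (g + h)" by transfer (auto simp: L1_rel_def add.assoc)
  show "f + g = g + f" by transfer (auto simp: L1_rel_def add.commute)
  show "0 + f = f" by transfer (auto simp: L1_rel_def)
  show "- f + f = 0" by transfer (auto simp: L1_rel_def)
  show "f - g = f + - g" by transfer (auto simp: L1_rel_def)
  show "r *\<^sub>R (f + g) = r *\<^sub>R f + r *\<^sub>R g" by transfer (auto simp: L1_rel_def algebra_simps)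
  show "(r + s) *\<^sub>R f = r *\<^sub>R f + s *\<^sub>R f" by transfer (auto simp: L1_rel_def algebra_simps)
  show "r *\<^sub>R s *\<^sub>R f = (r * s) *\<^sub>R f" by transfer (auto simp: L1_rel_def)
  show "1 *\<^sub>R f = f" by transfer (auto simp: L1_rel_def)
  show "a *\<^sub>C (f + g) = a *\<^sub>C f + a *\<^sub>C g" by transfer (auto simp: L1_rel_def algebra_simps)
  show "(a + b) *\<^sub>C f = a *\<^sub>C f + b *\<^sub>C f" by transfer (auto simp: L1_rel_def algebra_simps)
  show "a *\<^sub>C b *\<^sub>C f = (a * b) *\<^sub>C f" by transfer (auto simp: L1_rel_def mult.assoc)
  show "complex_of_real r *\<^sub>C f = r *\<^sub>R f"
    by transfer (auto simp: L1_rel_def scaleR_conv_of_real)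
  show "dist f g = norm (f - g)" by (rule dist_L1_def)
  show "sgn f = inverse (norm f) *\<^sub>R f" by (rule sgn_L1_def)
  show "uniformity = (INF e\<in>{0<..}. principal {(f, g::'a L1). dist f g < e})"
    by (rule uniformity_L1_def)
  show "open S = (\<forall>x\<in>S. \<forall>\<^sub>F (x', y) in uniformity. x' = x \<longrightarrow> y \<in> S)" by (rule open_L1_def)
  show "(norm f = 0) = (f = 0)"
  proof transfer
    fix f :: "'a \<Rightarrow> complex"
    assume "L1_rel f f"
    then have f: "integrable lborel f" by (simp add: L1_rel_def)
    then show "((\<integral>x. cmod (f x) \<partial>lborel) = 0) = L1_rel f (\<lambda>_. 0)"
      by (subst integral_nonneg_eq_0_iff_AE) (auto simp: L1_rel_def)
  qed
  show "norm (f + g) \<le> norm f + norm g"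
  proof transfer
    fix f g :: "'a \<Rightarrow> complex"
    assume "L1_rel f f" "L1_rel g g"
    then have i: "integrable lborel f" "integrable lborel g" by (simp_all add: L1_rel_def)
    then have "(\<integral>x. cmod (f x + g x) \<partial>lborel) \<le> (\<integral>x. cmod (f x) + cmod (g x) \<partial>lborel)"
      by (intro integral_mono) (auto intro: norm_triangle_ineq)
    also have "\<dots> = (\<integral>x. cmod (f x) \<partial>lborel) + (\<integral>x. cmod (g x) \<partial>lborel)"
      using i by simp
    finally show "(\<integral>x. cmod (f x + g x) \<partial>lborel)
        \<le> (\<integral>x. cmod (f x) \<partial>lborel) + (\<integral>x. cmod (g x) \<partial>lborel)" .
  qed
  show "norm (r *\<^sub>R f) = \<bar>r\<bar> * norm f" by transfer simp
  show "norm (a *\<^sub>C f) = cmod a * norm f" by transfer (simp add: norm_mult)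
qed

end

lemma sq_integrable_mult:
  assumes "sq_integrable f" "sq_integrable g"
  shows "integrable lborel (\<lambda>x. f x * g x)"
proof (rule Bochner_Integration.integrable_bound)
  show "integrable lborel (\<lambda>x. (cmod (f x))\<^sup>2 + (cmod (g x))\<^sup>2)"
    using assms by (simp add: sq_integrable_def)
  have "cmod (f x * g x) \<le> (cmod (f x))\<^sup>2 + (cmod (g x))\<^sup>2" for x
    using sum_squares_bound[of "cmod (f x)" "cmod (g x)"]
      mult_nonneg_nonneg[OF norm_ge_zero[of "f x"] norm_ge_zero[of "g x"]]
    unfolding norm_mult by linarith
  then show "AE x in lborel. cmod (f x * g x) \<le> norm ((cmod (f x))\<^sup>2 + (cmod (g x))\<^sup>2)" by simp
qed (use assms in \<open>auto simp: sq_integrable_def\<close>)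

lemma sq_integrable_cmult: "sq_integrable f \<Longrightarrow> sq_integrable (\<lambda>x. a * f x)"
  by (auto simp: sq_integrable_def norm_mult power_mult_distrib)

lemma borel_measurable_cnj [measurable]:
  "f \<in> borel_measurable M \<Longrightarrow> (\<lambda>x. cnj (f x)) \<in> borel_measurable M"
  by (rule measurable_compose) (auto intro: borel_measurable_continuous_onI continuous_on_cnj continuous_on_id)

lemma sq_integrable_cnj: "sq_integrable f \<Longrightarrow> sq_integrable (\<lambda>x. cnj (f x))"
  by (auto simp: sq_integrable_def)

lemma sq_integrable_add:
  assumes "sq_integrable f" "sq_integrable g"
  shows "sq_integrable (\<lambda>x. f x + g x)"
  unfolding sq_integrable_def
proof
  have m: "f \<in> borel_measurable lborel" "g \<in> borel_measurable lborel"
    using assms by (simp_all add: sq_integrable_def)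
  then show "(\<lambda>x. f x + g x) \<in> borel_measurable lborel" by simp
  show "integrable lborel (\<lambda>x. (cmod (f x + g x))\<^sup>2)"
  proof (rule Bochner_Integration.integrable_bound)
    show "integrable lborel (\<lambda>x. 2 * (cmod (f x))\<^sup>2 + 2 * (cmod (g x))\<^sup>2)"
      using assms by (simp add: sq_integrable_def)
    have "(cmod (f x + g x))\<^sup>2 \<le> 2 * (cmod (f x))\<^sup>2 + 2 * (cmod (g x))\<^sup>2" for x
    proof -
      have "(cmod (f x + g x))\<^sup>2 \<le> (cmod (f x) + cmod (g x))\<^sup>2"
        by (intro power_mono norm_triangle_ineq norm_ge_zero)
      also have "\<dots> \<le> 2 * (cmod (f x))\<^sup>2 + 2 * (cmod (g x))\<^sup>2"
        using sum_squares_bound[of "cmod (f x)" "cmod (g x)"] by (simp add: power2_sum)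
      finally show ?thesis .
    qed
    then show "AE x in lborel. norm ((cmod (f x + g x))\<^sup>2)
        \<le> norm (2 * (cmod (f x))\<^sup>2 + 2 * (cmod (g x))\<^sup>2)" by simp
  qed (use m in simp)
qed

instantiation L2 :: (euclidean_space) complex_inner
begin

lift_definition zero_L2 :: "'a L2" is "\<lambda>_. 0" by (simp add: L2_rel_def sq_integrable_def)
lift_definition plus_L2 :: "'a L2 \<Rightarrow> 'a L2 \<Rightarrow> 'a L2" is "\<lambda>f g x. f x + g x"
  by (auto simp: L2_rel_def intro: sq_integrable_add elim!: AE_mp)
lift_definition uminus_L2 :: "'a L2 \<Rightarrow> 'a L2" is "\<lambda>f x. - f x"
  by (auto simp: L2_rel_def sq_integrable_def)
lift_definition scaleC_L2 :: "complex \<Rightarrow> 'a L2 \<Rightarrow> 'a L2" is "\<lambda>a f x. a * f x"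
  by (auto simp: L2_rel_def intro: sq_integrable_cmult)
lift_definition cinner_L2 :: "'a L2 \<Rightarrow> 'a L2 \<Rightarrow> complex" is
  "\<lambda>f g. \<integral>x. f x * cnj (g x) \<partial>lborel"
  by (rule integral_cong_AE) (auto simp: L2_rel_def sq_integrable_def elim!: AE_mp)

definition minus_L2 :: "'a L2 \<Rightarrow> 'a L2 \<Rightarrow> 'a L2" where "minus_L2 f g = f + - g"
definition scaleR_L2 :: "real \<Rightarrow> 'a L2 \<Rightarrow> 'a L2" where "scaleR_L2 r f = complex_of_real r *\<^sub>C f"
definition inner_L2 :: "'a L2 \<Rightarrow> 'a L2 \<Rightarrow> real" where "inner_L2 f g = Re (cinner f g)"
definition norm_L2 :: "'a L2 \<Rightarrow> real" where "norm_L2 f = sqrt (inner f f)"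
definition dist_L2 :: "'a L2 \<Rightarrow> 'a L2 \<Rightarrow> real" where "dist_L2 f g = norm (f - g)"
definition sgn_L2 :: "'a L2 \<Rightarrow> 'a L2" where "sgn_L2 f = inverse (norm f) *\<^sub>R f"
definition uniformity_L2 :: "('a L2 \<times> 'a L2) filter" where
  "uniformity_L2 = (INF e\<in>{0<..}. principal {(f, g). dist f g < e})"
definition open_L2 :: "'a L2 set \<Rightarrow> bool" where
  "open_L2 S = (\<forall>x\<in>S. \<forall>\<^sub>F (x', y) in uniformity. x' = x \<longrightarrow> y \<in> S)"

instance
proof
  fix f g h :: "'a L2" and a b :: complex and r s :: real and S :: "'a L2 set"
  have C: "a *\<^sub>C (f + g) = a *\<^sub>C f + a *\<^sub>C g" for a and f g :: "'a L2"
    by transfer (auto simp: L2_rel_def algebra_simps intro: sq_integrable_cmult sq_integrable_add)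
  have D: "(a + b) *\<^sub>C f = a *\<^sub>C f + b *\<^sub>C f" for a b and f :: "'a L2"
    by transfer (auto simp: L2_rel_def algebra_simps intro: sq_integrable_cmult sq_integrable_add)
  have E: "a *\<^sub>C b *\<^sub>C f = (a * b) *\<^sub>C f" for a b and f :: "'a L2"
    by transfer (auto simp: L2_rel_def mult.assoc intro: sq_integrable_cmult)
  show "f + g + h = f + (g + h)"
    by transfer (auto simp: L2_rel_def add.assoc intro: sq_integrable_add)
  show "f + g = g + f" by transfer (auto simp: L2_rel_def add.commute intro: sq_integrable_add)
  show "0 + f = f" by transfer (auto simp: L2_rel_def)
  show "- f + f = 0" by transfer (auto simp: L2_rel_def sq_integrable_def)
  show "f - g = f + - g" by (rule minus_L2_def)
  show "a *\<^sub>C (f + g) = a *\<^sub>C f + a *\<^sub>C g" by (rule C)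
  show "(a + b) *\<^sub>C f = a *\<^sub>C f + b *\<^sub>C f" by (rule D)
  show "a *\<^sub>C b *\<^sub>C f = (a * b) *\<^sub>C f" by (rule E)
  show "complex_of_real r *\<^sub>C f = r *\<^sub>R f" by (rule scaleR_L2_def[symmetric])
  show "r *\<^sub>R (f + g) = r *\<^sub>R f + r *\<^sub>R g" by (simp add: scaleR_L2_def C)
  show "(r + s) *\<^sub>R f = r *\<^sub>R f + s *\<^sub>R f" by (simp add: scaleR_L2_def D)
  show "r *\<^sub>R s *\<^sub>R f = (r * s) *\<^sub>R f" by (simp add: scaleR_L2_def E)
  show "1 *\<^sub>R f = f" unfolding scaleR_L2_def by transfer (auto simp: L2_rel_def)
  show "dist f g = norm (f - g)" by (rule dist_L2_def)
  show "sgn f = inverse (norm f) *\<^sub>R f" by (rule sgn_L2_def)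
  show "uniformity = (INF e\<in>{0<..}. principal {(f, g::'a L2). dist f g < e})"
    by (rule uniformity_L2_def)
  show "open S = (\<forall>x\<in>S. \<forall>\<^sub>F (x', y) in uniformity. x' = x \<longrightarrow> y \<in> S)" by (rule open_L2_def)
  show "norm f = sqrt (inner f f)" by (rule norm_L2_def)
  show "inner f g = Re (cinner f g)" by (rule inner_L2_def)
  have K: "cinner f g = cnj (cinner g f)" for f g :: "'a L2"
    by transfer (subst Bochner_Integration.integral_cnj[symmetric], simp add: mult.commute)
  have A: "cinner (f + g) h = cinner f h + cinner g h" for f g h :: "'a L2"
    by transfer (auto simp: L2_rel_def distrib_right
        intro!: Bochner_Integration.integral_add sq_integrable_mult sq_integrable_cnj)
  have M: "cinner (a *\<^sub>C f) g = a * cinner f g" for a and f g :: "'a L2"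
    by transfer (simp add: mult.assoc)
  show "cinner f g = cnj (cinner g f)" by (rule K)
  show "cinner (f + g) h = cinner f h + cinner g h" by (rule A)
  show "cinner (a *\<^sub>C f) g = a * cinner f g" by (rule M)
  show "inner f g = inner g f" unfolding inner_L2_def by (subst K) simp
  show "inner (f + g) h = inner f h + inner g h" by (simp add: inner_L2_def A)
  show "inner (r *\<^sub>R f) g = r * inner f g" by (simp add: inner_L2_def scaleR_L2_def M)
  have sq': "Re (\<integral>x. F x * cnj (F x) \<partial>lborel) = (\<integral>x. (cmod (F x))\<^sup>2 \<partial>lborel)"
    for F :: "'a \<Rightarrow> complex"
    unfolding complex_norm_square[symmetric] integral_complex_of_real by simp
  show "0 \<le> inner f f" unfolding inner_L2_def by transfer (simp add: sq')
  show "(inner f f = 0) = (f = 0)"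
    unfolding inner_L2_def
  proof transfer
    fix f :: "'a \<Rightarrow> complex"
    assume "L2_rel f f"
    then have f: "integrable lborel (\<lambda>x. (cmod (f x))\<^sup>2)" "sq_integrable f"
      by (simp_all add: L2_rel_def sq_integrable_def)
    then show "(Re (\<integral>x. f x * cnj (f x) \<partial>lborel) = 0) = L2_rel f (\<lambda>_. 0)"
      unfolding sq' by (subst integral_nonneg_eq_0_iff_AE) (auto simp: L2_rel_def sq_integrable_def)
  qed
qed

end

section \<open>The twisted convolution algebra\<close>

lemma lborel_affine_sign:
  fixes t :: "'a::euclidean_space"
  assumes "c = 1 \<or> c = - 1"
  shows "distr lborel borel (\<lambda>x. t + c *\<^sub>R x) = lborel"
  using lborel_affine[of c t] assms by (auto simp: density_1)

lemma AE_lborel_affine_sign: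
  fixes t :: "'a::euclidean_space"
  assumes "c = 1 \<or> c = - 1" "AE x in lborel. P x"
  shows "AE x in lborel. P (t + c *\<^sub>R x)"
proof -
  have "AE x in distr lborel borel (\<lambda>x. t + c *\<^sub>R x). P x"
    unfolding lborel_affine_sign[OF assms(1)] by (rule assms(2))
  then show ?thesis by (rule AE_distrD[rotated]) simp
qed

lemma integrable_lborel_affine_sign:
  fixes t :: "'a::euclidean_space" and f :: "'a \<Rightarrow> 'b::{banach, second_countable_topology}"
  assumes "c = 1 \<or> c = - 1" "integrable lborel f"
  shows "integrable lborel (\<lambda>x. f (t + c *\<^sub>R x))"
  by (rule integrable_distr[of "\<lambda>x. t + c *\<^sub>R x" lborel borel])
    (simp_all add: lborel_affine_sign[OF assms(1)] assms(2))

lemma integral_lborel_affine_sign: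
  fixes t :: "'a::euclidean_space" and f :: "'a \<Rightarrow> 'b::{banach, second_countable_topology}"
  assumes "c = 1 \<or> c = - 1" "f \<in> borel_measurable borel"
  shows "(\<integral>x. f (t + c *\<^sub>R x) \<partial>lborel) = (\<integral>x. f x \<partial>lborel)"
  using integral_distr[of "\<lambda>x. t + c *\<^sub>R x" lborel borel f] assms
  by (simp add: lborel_affine_sign)

definition twisted_integrand ::
    "real \<Rightarrow> (complex ^ 'n \<Rightarrow> complex) \<Rightarrow> (complex ^ 'n \<Rightarrow> complex) \<Rightarrow> complex ^ 'n \<Rightarrow> complex ^ 'n \<Rightarrow> complex"
  where "twisted_integrand l f g z w =
    f (z - w) * g w * exp (\<i> * complex_of_real (l / 2 * Im (hdot z w)))"

lemma twisted_integrand_integrable: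
  fixes f g :: "complex ^ 'n \<Rightarrow> complex"
  assumes f: "integrable lborel f" and g: "integrable lborel g"
  shows "integrable lborel (\<lambda>z. \<integral>w. twisted_integrand l f g z w \<partial>lborel)"
proof -
  have mf[measurable]: "f \<in> borel_measurable borel" and mg[measurable]: "g \<in> borel_measurable borel"
    using f g by (simp_all add: integrable_iff_bounded)
  define e where "e p = exp (\<i> * complex_of_real (l / 2 * Im (hdot (snd p) (fst p))))"
    for p :: "(complex ^ 'n) \<times> (complex ^ 'n)"
  have "continuous_on UNIV e"
    unfolding e_def hdot_def by (intro continuous_intros)
  then have me[measurable]: "e \<in> borel_measurable (borel \<Otimes>\<^sub>M borel)"
    unfolding borel_prod by (rule borel_measurable_continuous_onI)
  have e1: "cmod (e p) = 1" for p by (simp add: e_def)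
  define F where "F = (\<lambda>(w, z). f (z - w) * g w * e (w, z))"
  have mF: "F \<in> borel_measurable (lborel \<Otimes>\<^sub>M lborel)"
    unfolding F_def by measurable
  have tr: "f (z - w) = f (- w + 1 *\<^sub>R z)" for z w by simp
  have sect: "integrable lborel (\<lambda>z. F (w, z))" for w
  proof (rule Bochner_Integration.integrable_bound)
    show "integrable lborel (\<lambda>z. f (z - w) * g w)"
      unfolding tr by (intro integrable_mult_left integrable_lborel_affine_sign f) simp
    show "(\<lambda>z. F (w, z)) \<in> borel_measurable lborel"
      using mF by measurable
  qed (simp add: F_def norm_mult e1)
  have nrm: "(\<integral>z. norm (F (w, z)) \<partial>lborel) = (\<integral>z. cmod (f z) \<partial>lborel) * cmod (g w)" for w
  proof -
    have "(\<integral>z. norm (F (w, z)) \<partial>lborel) = (\<integral>z. cmod (f (- w + 1 *\<^sub>R z)) * cmod (g w) \<partial>lborel)"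
      by (simp add: F_def norm_mult e1)
    also have "\<dots> = (\<integral>z. cmod (f (- w + 1 *\<^sub>R z)) \<partial>lborel) * cmod (g w)"
      by (rule integral_mult_left_zero)
    also have "(\<integral>z. cmod (f (- w + 1 *\<^sub>R z)) \<partial>lborel) = (\<integral>z. cmod (f z) \<partial>lborel)"
      by (rule integral_lborel_affine_sign[where f = "\<lambda>z. cmod (f z)"]) simp_all
    finally show ?thesis .
  qed
  have "integrable (lborel \<Otimes>\<^sub>M lborel) F"
    by (rule lborel_pair.Fubini_integrable[OF mF]) (use g in \<open>auto simp: nrm sect\<close>)
  then have "integrable lborel (\<lambda>z. \<integral>w. F (w, z) \<partial>lborel)"
    by (intro lborel_pair.integrable_snd) (simp add: case_prod_eta)
  then show ?thesis by (simp add: F_def e_def twisted_integrand_def)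
qed

lift_definition twisted_conv ::
    "real \<Rightarrow> (complex ^ 'n) L1 \<Rightarrow> (complex ^ 'n) L1 \<Rightarrow> (complex ^ 'n) L1"
  is "\<lambda>l f g z. \<integral>w. f (z - w) * g w * exp (\<i> * complex_of_real (l / 2 * Im (hdot z w))) \<partial>lborel"
proof -
  fix l :: real and f f' g g' :: "complex ^ 'n \<Rightarrow> complex"
  assume f: "L1_rel f f'" and g: "L1_rel g g'"
  have eq: "(\<integral>w. twisted_integrand l f g z w \<partial>lborel) = (\<integral>w. twisted_integrand l f' g' z w \<partial>lborel)" for z
  proof (rule integral_cong_AE)
    have [measurable]: "f \<in> borel_measurable borel" "g \<in> borel_measurable borel"
      "f' \<in> borel_measurable borel" "g' \<in> borel_measurable borel"
      using f g by (simp_all add: L1_rel_def integrable_iff_bounded)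
    have [measurable]: "(\<lambda>w. exp (\<i> * complex_of_real (l / 2 * Im (hdot z w)))) \<in> borel_measurable borel"
      unfolding hdot_def by (intro borel_measurable_continuous_onI continuous_intros)
    show "twisted_integrand l f g z \<in> borel_measurable lborel"
      "twisted_integrand l f' g' z \<in> borel_measurable lborel"
      unfolding twisted_integrand_def by measurable
    have "AE w in lborel. f (z + (- 1) *\<^sub>R w) = f' (z + (- 1) *\<^sub>R w)"
      by (rule AE_lborel_affine_sign) (use f in \<open>auto simp: L1_rel_def\<close>)
    moreover have "AE w in lborel. g w = g' w" using g by (simp add: L1_rel_def)
    ultimately show "AE w in lborel. twisted_integrand l f g z w = twisted_integrand l f' g' z w"
      by eventually_elim (simp add: twisted_integrand_def)
  qed
  show "L1_rel
     (\<lambda>z. \<integral>w. f (z - w) * g w * exp (\<i> * complex_of_real (l / 2 * Im (hdot z w))) \<partial>lborel)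
     (\<lambda>z. \<integral>w. f' (z - w) * g' w * exp (\<i> * complex_of_real (l / 2 * Im (hdot z w))) \<partial>lborel)"
    using f g eq twisted_integrand_integrable[of f g l] twisted_integrand_integrable[of f' g' l]
    unfolding twisted_integrand_def by (simp add: L1_rel_def)
qed

lift_definition L1_star :: "(complex ^ 'n) L1 \<Rightarrow> (complex ^ 'n) L1" is "\<lambda>f z. cnj (f (- z))"
proof -
  fix f f' :: "complex ^ 'n \<Rightarrow> complex"
  assume "L1_rel f f'"
  then show "L1_rel (\<lambda>z. cnj (f (- z))) (\<lambda>z. cnj (f' (- z)))"
    using integrable_lborel_affine_sign[of "- 1" f 0] integrable_lborel_affine_sign[of "- 1" f' 0]
      AE_lborel_affine_sign[of "- 1" "\<lambda>z. f z = f' z" 0]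
    by (simp add: L1_rel_def)
qed

end

theory Submission
  imports Defs
begin

text \<open>
  If \<open>T f = \<integral> f z \<rho> z dz\<close> for some projective representation \<open>\<rho>\<close>, then \<open>\<rho> z (T f) = T (L\<^sub>z f)\<close>,
  where the twisted translation \<open>(L\<^sub>z f) u = f (u - z) exp (i l Im (z \<cdot> cnj u) / 2)\<close> makes
  no reference to \<open>\<rho>\<close>.  The proof turns this into a construction of \<open>\<rho>\<close>.  The translations are isometries of \<open>L\<^sup>1\<close>,
  multiply like the Heisenberg group with \<open>t\<close> acting by \<open>exp (i l t)\<close>, move continuously, commute with
  convolution from the right, and satisfy \<open>(L\<^sub>z g)\<^sup>* * L\<^sub>z f = g\<^sup>* * f\<close>.  Because \<open>T\<close> is a \<open>*\<close>-homomorphism,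
  the last identity gives \<open>\<langle>T (L\<^sub>z f) u, T (L\<^sub>z g) v\<rangle> = \<langle>T f u, T g v\<rangle>\<close>, the unitarity of \<open>\<rho> z\<close>.

  Let \<open>\<phi>\<^sub>n\<close> be an approximate identity, here normalised indicators of shrinking balls, and let \<open>H\<close> be
  the set of vectors \<open>u\<close> with \<open>T \<phi>\<^sub>n u \<longlongrightarrow> u\<close>.  It is a closed subspace because the operators \<open>T \<phi>\<^sub>n\<close>
  are uniformly bounded, and it contains all \<open>T f v\<close> because \<open>\<phi>\<^sub>n * f \<longlongrightarrow> f\<close>.  On \<open>H\<close> one can define
  \<open>\<rho> z u\<close> as the limit of \<open>T (L\<^sub>z \<phi>\<^sub>n) u\<close>: by the unitarity identity this sequence is Cauchy as soon as
  \<open>T \<phi>\<^sub>n u\<close> is, and \<open>\<rho>\<close> inherits isometry, group law and continuity from the translations.  A vector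
  orthogonal to \<open>H\<close> is orthogonal to every \<open>T f v\<close>, hence killed by every \<open>T f\<^sup>*\<close>, so the orthogonal
  projection onto \<open>H\<close> yields the decomposition of the Hilbert space.

  The integral formula rests on the observation that \<open>f * g\<close> is the \<open>f\<close>-weighted average of the
  translates \<open>L\<^sub>z g\<close>.  If \<open>h\<close> lives where \<open>L\<^sub>z g\<close> is within \<open>\<epsilon>\<close> of \<open>L\<^sub>a g\<close>, then \<open>h * g\<close> differs from
  \<open>(\<integral> h) L\<^sub>a g\<close> by at most \<open>\<epsilon> \<parallel>h\<parallel>\<close> (\<open>norm_twisted_conv_minus_shift_le\<close>).  Thus
  \<open>h \<mapsto> \<langle>T h u, v\<rangle>\<close> behaves near each point \<open>a\<close> like integration against the constant
  \<open>\<langle>\<rho> a u, v\<rangle>\<close>, and a countable partition into small pieces shows that it is integration against the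
  function \<open>\<langle>\<rho> z u, v\<rangle>\<close> (\<open>L1_functional_eq_integral\<close>).

  Both the projection and the definition of \<open>\<rho>\<close> need completeness of \<open>L\<^sup>2\<close>, the Riesz--Fischer
  theorem.
\<close>

section \<open>Complex Hilbert spaces\<close>

lemma scaleR_closed_csubspace: "closed_csubspace S \<Longrightarrow> x \<in> S \<Longrightarrow> r *\<^sub>R x \<in> S"
  unfolding closed_csubspace_def by (metis scaleC_of_real)

lemma diff_closed_csubspace: "closed_csubspace S \<Longrightarrow> x \<in> S \<Longrightarrow> y \<in> S \<Longrightarrow> x - y \<in> S"
  using scaleR_closed_csubspace[of S y "-1"] unfolding closed_csubspace_def
  by (metis add_uminus_conv_diff scaleR_minus1_left)

lemma cinner_add_right: "cinner x (y + z) = cinner x y + cinner x z"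
  by (metis cinner_commute cinner_add_left complex_cnj_add)

lemma cinner_minus_left [simp]: "cinner (- x) y = - cinner x y"
  using cinner_scaleC_left[of "of_real (- 1)" x y] unfolding scaleC_of_real by simp

lemma cinner_diff_left: "cinner (x - y) z = cinner x z - cinner y z"
  using cinner_add_left[of x "- y" z] by simp

lemma cinner_diff_right: "cinner z (x - y) = cinner z x - cinner z y"
  by (metis cinner_commute cinner_diff_left complex_cnj_diff)

text \<open>Rotating \<open>x\<close> by a phase makes the complex inner product real and nonnegative, which reduces the
  claim to the real Cauchy--Schwarz inequality.\<close>

lemma norm_cinner_le: "cmod (cinner x y) \<le> norm x * norm y"
proof -
  define c where "c = cnj (sgn (cinner x y))"
  have "complex_of_real (cmod (cinner x y)) = cinner (c *\<^sub>C x) y"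
    using complex_norm_square[of "cinner x y"]
    by (cases "cinner x y = 0")
      (auto simp: c_def cinner_scaleC_left sgn_eq mult.commute power2_eq_square field_simps)
  then have "cmod (cinner x y) = inner (c *\<^sub>C x) y"
    by (metis Re_complex_of_real inner_eq_Re_cinner)
  also have "\<dots> \<le> norm (c *\<^sub>C x) * norm y"
    by (rule norm_cauchy_schwarz)
  also have "\<dots> \<le> norm x * norm y"
    by (intro mult_right_mono) (auto simp: c_def norm_scaleC norm_sgn)
  finally show ?thesis .
qed

lemma bounded_bilinear_cinner:
  "bounded_bilinear (cinner :: 'a::complex_inner \<Rightarrow> 'a \<Rightarrow> complex)"
proof
  fix a a' b b' :: 'a and r :: real
  show "cinner (a + a') b = cinner a b + cinner a' b" by (rule cinner_add_left)
  show "cinner a (b + b') = cinner a b + cinner a b'" by (rule cinner_add_right)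
  show "cinner (r *\<^sub>R a) b = r *\<^sub>R cinner a b"
    by (simp flip: scaleC_of_real add: cinner_scaleC_left scaleR_conv_of_real)
  show "cinner a (r *\<^sub>R b) = r *\<^sub>R cinner a b"
    by (simp flip: scaleC_of_real add: cinner_scaleC_right scaleR_conv_of_real)
  show "\<exists>K. \<forall>a b. norm (cinner (a::'a) b) \<le> norm a * norm b * K"
    by (intro exI[of _ 1] allI) (simp add: norm_cinner_le)
qed

lemmas tendsto_cinner = bounded_bilinear.tendsto[OF bounded_bilinear_cinner]
lemmas continuous_on_cinner = bounded_bilinear.continuous_on[OF bounded_bilinear_cinner]

text \<open>The projection theorem for Hilbert spaces: a sequence in \<open>S\<close> that minimises the distance to \<open>u\<close> is
  Cauchy by the parallelogram law, and the difference between \<open>u\<close> and its limit is orthogonal to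
  \<open>S\<close>, since otherwise moving within \<open>S\<close> would come closer to \<open>u\<close>.\<close>

lemma exists_orthogonal_decomposition:
  fixes S :: "'a::{complex_inner, complete_space} set"
  assumes S: "closed_csubspace S"
  obtains x y where "x \<in> S" "u = x + y" "\<And>w. w \<in> S \<Longrightarrow> cinner w y = 0"
proof -
  have ne: "S \<noteq> {}" using S by (auto simp: closed_csubspace_def)
  define d where "d = infdist u S"
  have d0: "0 \<le> d" by (simp add: d_def infdist_nonneg)
  have dle: "d \<le> norm (u - w)" if "w \<in> S" for w
    unfolding d_def using infdist_le[OF that, of u] by (simp add: dist_norm)
  have "\<exists>w\<in>S. norm (u - w) < d + 1 / real (Suc n)" for n
  proof -
    have "infdist u S < d + 1 / real (Suc n)" by (simp add: d_def)
    then show ?thesis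
      using ne cINF_less_iff[OF ne bdd_belowI2[of S 0 "\<lambda>w. norm (u - w)"]]
      unfolding infdist_def dist_norm by auto
  qed
  then obtain s where sS: "\<And>n. s n \<in> S" and sd: "\<And>n. norm (u - s n) < d + 1 / real (Suc n)"
    by metis
  have lim: "(\<lambda>n. (d + 1 / real (Suc n))\<^sup>2) \<longlonglongrightarrow> (d + 0)\<^sup>2"
    by (intro tendsto_intros LIMSEQ_Suc lim_1_over_n)
  have sq: "(norm (u - s n))\<^sup>2 \<le> (d + 1 / real (Suc n))\<^sup>2" for n
    using sd[of n] by (intro power_mono) auto
  \<comment> \<open>The parallelogram law, with the fact that the midpoint of two points of \<open>S\<close> has distance at
    least \<open>d\<close> from \<open>u\<close>.\<close>
  have par: "(norm (s m - s n))\<^sup>2 \<le> 2 * ((norm (u - s m))\<^sup>2 - d\<^sup>2) + 2 * ((norm (u - s n))\<^sup>2 - d\<^sup>2)" for m n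
  proof -
    have "(1/2) *\<^sub>R (s m + s n) \<in> S"
      using S sS by (intro scaleR_closed_csubspace) (auto simp: closed_csubspace_def)
    then have "d\<^sup>2 \<le> (norm (u - (1/2) *\<^sub>R (s m + s n)))\<^sup>2"
      using dle d0 by (intro power_mono) auto
    moreover have "(norm (s m - s n))\<^sup>2
        = 2 * (norm (u - s m))\<^sup>2 + 2 * (norm (u - s n))\<^sup>2 - 4 * (norm (u - (1/2) *\<^sub>R (s m + s n)))\<^sup>2"
      unfolding power2_norm_eq_inner
      by (simp add: inner_diff_left inner_diff_right inner_add_left inner_add_right inner_commute algebra_simps)
    ultimately show ?thesis by simp
  qed
  have "Cauchy s"
  proof (rule metric_CauchyI)
    fix e :: real assume "0 < e"
    then have "\<forall>\<^sub>F n in sequentially. (d + 1 / real (Suc n))\<^sup>2 < d\<^sup>2 + e\<^sup>2 / 4"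
      using lim by (intro order_tendstoD) auto
    then obtain N where N: "\<And>n. n \<ge> N \<Longrightarrow> (d + 1 / real (Suc n))\<^sup>2 < d\<^sup>2 + e\<^sup>2 / 4"
      by (auto simp: eventually_sequentially)
    show "\<exists>N. \<forall>m\<ge>N. \<forall>n\<ge>N. dist (s m) (s n) < e"
    proof (intro exI allI impI)
      fix m n assume "N \<le> m" "N \<le> n"
      then have "(norm (s m - s n))\<^sup>2 < e\<^sup>2"
        using par[of m n] le_less_trans[OF sq[of m] N[of m]] le_less_trans[OF sq[of n] N[of n]]
        by (simp add: algebra_simps)
      then show "dist (s m) (s n) < e"
        using \<open>0 < e\<close> by (simp add: dist_norm power_less_imp_less_base)
    qed
  qed
  then obtain x where x: "s \<longlonglongrightarrow> x" using Cauchy_convergent convergent_def by blast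
  have xS: "x \<in> S" using S sS x by (auto simp: closed_csubspace_def intro: closed_sequentially)
  have "(norm (u - x))\<^sup>2 \<le> (d + 0)\<^sup>2"
  proof (rule LIMSEQ_le[OF _ lim])
    show "(\<lambda>n. (norm (u - s n))\<^sup>2) \<longlonglongrightarrow> (norm (u - x))\<^sup>2"
      by (intro tendsto_intros x)
  qed (use sq in blast)
  then have xd: "(norm (u - x))\<^sup>2 \<le> d\<^sup>2" by simp
  have orth: "inner w (u - x) = 0" if w: "w \<in> S" for w
  proof (cases "w = 0")
    case False
    \<comment> \<open>The value of \<open>t\<close> for which \<open>x + t *\<^sub>R w\<close> is nearest to \<open>u\<close>.\<close>
    define t where "t = inner w (u - x) / (norm w)\<^sup>2"
    have "x + t *\<^sub>R w \<in> S"
      using S xS scaleR_closed_csubspace[OF S w] by (auto simp: closed_csubspace_def)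
    then have "d\<^sup>2 \<le> (norm (u - (x + t *\<^sub>R w)))\<^sup>2"
      using dle d0 by (intro power_mono) auto
    also have "\<dots> = (norm (u - x))\<^sup>2 - 2 * t * inner w (u - x) + t\<^sup>2 * (norm w)\<^sup>2"
      unfolding power2_norm_eq_inner
      by (simp add: inner_diff_left inner_diff_right inner_add_left inner_add_right inner_commute
          algebra_simps power2_eq_square)
    also have "t\<^sup>2 * (norm w)\<^sup>2 = t * inner w (u - x)"
      using False by (simp add: t_def power2_eq_square)
    finally have "t * inner w (u - x) \<le> 0" using xd by simp
    moreover have "t * inner w (u - x) = (inner w (u - x))\<^sup>2 / (norm w)\<^sup>2"
      by (simp add: t_def power2_eq_square)
    ultimately show ?thesis using False by (simp add: divide_le_0_iff)
  qed simp
  show thesis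
  proof (rule that[OF xS, of "u - x"])
    fix w assume w: "w \<in> S"
    \<comment> \<open>Real orthogonality to \<open>w\<close> and to \<open>- \<i> w\<close> gives the real and the imaginary part.\<close>
    then have "(- \<i>) *\<^sub>C w \<in> S" using S by (simp add: closed_csubspace_def)
    from orth[OF this] orth[OF w] show "cinner w (u - x) = 0"
      by (simp add: inner_eq_Re_cinner cinner_scaleC_left complex_eq_iff)
  qed simp
qed

lemma bounded_bilinear_scaleC:
  "bounded_bilinear (scaleC :: complex \<Rightarrow> 'a::complex_normed_vector \<Rightarrow> 'a)"
proof
  fix a a' :: complex and b b' :: 'a and r :: real
  show "(a + a') *\<^sub>C b = a *\<^sub>C b + a' *\<^sub>C b" by (rule scaleC_add_left)
  show "a *\<^sub>C (b + b') = a *\<^sub>C b + a *\<^sub>C b'" by (rule scaleC_add_right)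
  show "(r *\<^sub>R a) *\<^sub>C b = r *\<^sub>R a *\<^sub>C b"
    by (simp flip: scaleC_of_real add: scaleC_scaleC scaleR_conv_of_real)
  show "a *\<^sub>C r *\<^sub>R b = r *\<^sub>R a *\<^sub>C b"
    by (simp flip: scaleC_of_real add: scaleC_scaleC mult.commute)
  show "\<exists>K. \<forall>a b. norm (a *\<^sub>C (b::'a)) \<le> norm a * norm b * K"
    by (intro exI[of _ 1] allI) (simp add: norm_scaleC)
qed

lemmas tendsto_scaleC = bounded_bilinear.tendsto[OF bounded_bilinear_scaleC]
lemmas continuous_on_scaleC = bounded_bilinear.continuous_on[OF bounded_bilinear_scaleC]

lemma scaleC_one [simp]: "1 *\<^sub>C x = x"
  using scaleC_of_real[of 1 x] by simp

text \<open>The three-epsilon argument by which strong convergence to the identity passes from a dense set to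
  its closure; it is used both for translations on \<open>L\<^sup>1\<close> and for an approximate identity on the Hilbert
  space.\<close>

lemma closed_tendsto_self:
  fixes A :: "nat \<Rightarrow> 'a::real_normed_vector \<Rightarrow> 'a"
  assumes diff: "\<And>n x y. A n (x - y) = A n x - A n y"
    and bd: "\<And>n x. norm (A n x) \<le> K * norm x"
  shows "closed {x. (\<lambda>n. A n x) \<longlonglongrightarrow> x}"
  unfolding closed_sequential_limits
proof (intro allI impI, elim conjE, rule CollectI)
  fix s x assume s: "\<forall>i. s i \<in> {x. (\<lambda>n. A n x) \<longlonglongrightarrow> x}" and x: "s \<longlonglongrightarrow> x"
  have K: "0 \<le> \<bar>K\<bar>" "norm (A n y) \<le> \<bar>K\<bar> * norm y" for n y
    using bd[of n y] mult_right_mono[OF abs_ge_self[of K] norm_ge_zero[of y]] by auto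
  show "(\<lambda>n. A n x) \<longlonglongrightarrow> x"
  proof (rule LIMSEQ_I)
    fix e :: real assume e: "0 < e"
    define d where "d = e / (\<bar>K\<bar> + 2)"
    have d: "0 < d" "(\<bar>K\<bar> + 2) * d = e" using e by (simp_all add: d_def)
    obtain i where i: "norm (s i - x) < d" using LIMSEQ_D[OF x d(1)] by blast
    have "(\<lambda>n. A n (s i)) \<longlonglongrightarrow> s i" using s by blast
    then obtain N where N: "\<And>n. N \<le> n \<Longrightarrow> norm (A n (s i) - s i) < d" using LIMSEQ_D[OF _ d(1)] by blast
    have "norm (A n x - x) < e" if n: "N \<le> n" for n
    proof -
      have "norm (A n x - A n (s i)) \<le> \<bar>K\<bar> * norm (x - s i)" using K(2)[of n "x - s i"] by (simp add: diff)
      also have "\<dots> \<le> \<bar>K\<bar> * d" using i by (intro mult_left_mono) (auto simp: norm_minus_commute)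
      finally have "norm (A n x - A n (s i)) \<le> \<bar>K\<bar> * d" .
      moreover have "A n x - x = (A n x - A n (s i)) + ((A n (s i) - s i) + (s i - x))" by simp
      then have "norm (A n x - x) \<le> norm (A n x - A n (s i)) + (norm (A n (s i) - s i) + norm (s i - x))"
        by (metis norm_triangle_le norm_triangle_ineq add_left_mono)
      ultimately show ?thesis using N[OF n] i d(2) by (simp add: distrib_right)
    qed
    then show "\<exists>N. \<forall>n\<ge>N. norm (A n x - x) < e" by blast
  qed
qed

section \<open>Completeness of \<open>L\<^sup>2\<close>\<close>

lemma power2_norm_L2:
  assumes "sq_integrable f"
  shows "ennreal ((norm (L2 f))\<^sup>2) = (\<integral>\<^sup>+x. ennreal ((cmod (f x))\<^sup>2) \<partial>lborel)"
proof -
  have r: "L2_rel f f" using assms by (simp add: L2_rel_def)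
  have "complex_of_real ((norm (L2 f))\<^sup>2) = cinner (L2 f) (L2 f)"
    by (simp add: cinner_self)
  also have "\<dots> = (\<integral>x. f x * cnj (f x) \<partial>lborel)"
    using r by (rule cinner_L2.abs_eq[OF _ r])
  also have "\<dots> = complex_of_real (\<integral>x. (cmod (f x))\<^sup>2 \<partial>lborel)"
    unfolding complex_norm_square[symmetric] by (rule integral_complex_of_real)
  finally have "(norm (L2 f))\<^sup>2 = (\<integral>x. (cmod (f x))\<^sup>2 \<partial>lborel)"
    by (simp only: of_real_eq_iff)
  moreover have "(\<integral>\<^sup>+x. ennreal ((cmod (f x))\<^sup>2) \<partial>lborel) = ennreal (\<integral>x. (cmod (f x))\<^sup>2 \<partial>lborel)"
    using assms by (intro nn_integral_eq_integral) (auto simp: sq_integrable_def)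
  ultimately show ?thesis by simp
qed

lemma L2_rep_L2: "L2 (rep_L2 u) = u"
  using Quotient3_abs_rep[OF Quotient3_L2] .

lemma sq_integrable_rep_L2: "sq_integrable (rep_L2 u)"
  using Quotient3_rep_reflp[OF Quotient3_L2, of u] by (simp add: L2_rel_def)

lemma L2_diff:
  assumes "sq_integrable f" "sq_integrable g"
  shows "L2 f - L2 g = L2 (\<lambda>x. f x - g x)" "sq_integrable (\<lambda>x. f x - g x)"
proof -
  have r: "L2_rel f f" "L2_rel g g" "L2_rel (\<lambda>x. - g x) (\<lambda>x. - g x)"
    using assms by (simp_all add: L2_rel_def sq_integrable_def)
  show "L2 f - L2 g = L2 (\<lambda>x. f x - g x)"
    unfolding minus_L2_def uminus_L2.abs_eq[OF r(2)] plus_L2.abs_eq[OF r(1,3)] by simp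
  show "sq_integrable (\<lambda>x. f x - g x)"
    using sq_integrable_add[of f "\<lambda>x. - g x"] r by (simp add: L2_rel_def)
qed

lemma half_power_square: "((1/2)^n)\<^sup>2 = (1/4::real)^n"
proof -
  have "((1/2)^n)\<^sup>2 = ((1/2::real)\<^sup>2)^n" by (metis power_mult mult.commute)
  then show ?thesis by (simp add: power2_eq_square)
qed

text \<open>Riesz--Fischer.  A subsequence with distances below \<open>2\<^sup>-\<^sup>n\<close> converges almost everywhere, because
  \<open>\<Sum> 2\<^sup>n \<bar>f\<^sub>n\<^sub>+\<^sub>1 - f\<^sub>n\<bar>\<^sup>2\<close> has finite integral, and by Fatou's lemma the pointwise limit is also a limit in
  the norm.\<close>

instance L2 :: (euclidean_space) complete_space
proof
  fix X :: "nat \<Rightarrow> 'a L2"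
  assume X: "Cauchy X"
  have "\<forall>n. \<exists>N. \<forall>i\<ge>N. \<forall>j\<ge>N. norm (X i - X j) < (1/2)^n"
    using X by (auto simp: Cauchy_def dist_norm)
  then obtain N where N: "\<And>n i j. N n \<le> i \<Longrightarrow> N n \<le> j \<Longrightarrow> norm (X i - X j) < (1/2)^n"
    by metis
  \<comment> \<open>Summing the moduli of convergence and adding \<open>n\<close> makes the choice of indices strictly increasing.\<close>
  define r where "r n = n + (\<Sum>k\<le>n. N k)" for n
  have Nr: "N n \<le> r n" for n
    unfolding r_def by (simp add: member_le_sum trans_le_add2)
  have r: "strict_mono r"
    by (rule strict_mono_Suc_iff[THEN iffD2]) (simp add: r_def)
  have rd: "norm (X (r m) - X (r n)) < (1/2)^n" if "n \<le> m" for m n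
    using N Nr strict_mono_leD[OF r that] by (meson order_trans)
  define f where "f n = rep_L2 (X (r n))" for n
  have Xf: "X (r n) = L2 (f n)" and sf: "sq_integrable (f n)" for n
    by (simp_all add: f_def L2_rep_L2 sq_integrable_rep_L2)
  have [measurable]: "f n \<in> borel_measurable lborel" for n
    using sf[of n] by (simp add: sq_integrable_def)
  define F where "F x = lim (\<lambda>n. f n x)" for x
  have [measurable]: "F \<in> borel_measurable lborel"
    unfolding F_def by measurable
  have le: "(\<integral>\<^sup>+x. ennreal ((cmod (f m x - f n x))\<^sup>2) \<partial>lborel) \<le> ennreal ((1/4)^n)" if "n \<le> m" for m n
  proof -
    have "(norm (X (r m) - X (r n)))\<^sup>2 \<le> ((1/2)^n)\<^sup>2"
      using rd[OF that] by (intro power_mono) auto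
    also have "\<dots> = (1/4)^n" by (rule half_power_square)
    finally have "ennreal ((norm (X (r m) - X (r n)))\<^sup>2) \<le> ennreal ((1/4)^n)" by (rule ennreal_leI)
    then show ?thesis
      unfolding Xf L2_diff(1)[OF sf sf] by (simp add: power2_norm_L2[OF L2_diff(2)[OF sf sf]])
  qed
  have "(\<integral>\<^sup>+x. (\<Sum>n. ennreal (2^n * (cmod (f (Suc n) x - f n x))\<^sup>2)) \<partial>lborel)
      = (\<Sum>n. \<integral>\<^sup>+x. ennreal (2^n * (cmod (f (Suc n) x - f n x))\<^sup>2) \<partial>lborel)"
    by (rule nn_integral_suminf) measurable
  also have "\<dots> \<le> (\<Sum>n. ennreal ((1/2)^n))"
  proof (rule suminf_le)
    fix n
    have "(\<integral>\<^sup>+x. ennreal (2^n * (cmod (f (Suc n) x - f n x))\<^sup>2) \<partial>lborel)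
        = ennreal (2^n) * (\<integral>\<^sup>+x. ennreal ((cmod (f (Suc n) x - f n x))\<^sup>2) \<partial>lborel)"
      unfolding ennreal_mult'' [OF zero_le_power2] by (rule nn_integral_cmult) measurable
    also have "\<dots> \<le> ennreal (2^n) * ennreal ((1/4)^n)"
      by (intro mult_left_mono le) auto
    also have "\<dots> = ennreal ((1/2)^n)"
      by (simp add: ennreal_mult''[symmetric] power_mult_distrib[symmetric])
    finally show "(\<integral>\<^sup>+x. ennreal (2^n * (cmod (f (Suc n) x - f n x))\<^sup>2) \<partial>lborel) \<le> ennreal ((1/2)^n)" .
  qed auto
  also have "\<dots> < \<infinity>"
    by (simp add: suminf_ennreal2 summable_geometric)
  finally have "AE x in lborel. (\<Sum>n. ennreal (2^n * (cmod (f (Suc n) x - f n x))\<^sup>2)) \<noteq> \<infinity>"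
    by (intro nn_integral_PInf_AE) (auto simp: less_top[symmetric])
  then have conv: "AE x in lborel. (\<lambda>n. f n x) \<longlonglongrightarrow> F x"
  proof eventually_elim
    fix x assume "(\<Sum>n. ennreal (2^n * (cmod (f (Suc n) x - f n x))\<^sup>2)) \<noteq> \<infinity>"
    then have "summable (\<lambda>n. 2^n * (cmod (f (Suc n) x - f n x))\<^sup>2)"
      by (intro summable_suminf_not_top) auto
    then have sm: "summable (\<lambda>n. 2^n * (cmod (f (Suc n) x - f n x))\<^sup>2 + (1/2)^n)"
      by (intro summable_add summable_geometric) auto
    have "summable (\<lambda>n. f (Suc n) x - f n x)"
    proof (rule summable_comparison_test[OF _ sm], intro exI[of _ 0] allI impI)
      fix n
      define a where "a = cmod (f (Suc n) x - f n x)"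
      \<comment> \<open>\<open>2 a \<le> 2\<^sup>n a\<^sup>2 + 2\<^sup>-\<^sup>n\<close> bounds the increments themselves by two summable sequences.\<close>
      have "2 * (2^n * a) \<le> (2^n * a)\<^sup>2 + 1"
        using sum_squares_bound[of "2^n * a" 1] by simp
      then have "(1/2)^n * (2 * (2^n * a)) \<le> (1/2)^n * ((2^n * a)\<^sup>2 + 1)"
        by (intro mult_left_mono) auto
      moreover have "(1/2)^n * (2 * (2^n * a)) = 2 * a" "(1/2)^n * ((2^n * a)\<^sup>2 + 1) = 2^n * a\<^sup>2 + (1/2)^n"
        by (simp_all add: power2_eq_square power_divide field_simps)
      moreover have "0 \<le> a" by (simp add: a_def)
      ultimately show "cmod (f (Suc n) x - f n x) \<le> 2^n * (cmod (f (Suc n) x - f n x))\<^sup>2 + (1/2)^n"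
        unfolding a_def[symmetric] by linarith
    qed
    then have "convergent (\<lambda>n. f n x)"
      by (simp add: summable_iff_convergent sum_lessThan_telescope[of "\<lambda>n. f n x"]
          convergent_diff_const_right_iff)
    then show "(\<lambda>n. f n x) \<longlonglongrightarrow> F x" by (simp add: F_def convergent_LIMSEQ_iff)
  qed
  have fatou: "(\<integral>\<^sup>+x. ennreal ((cmod (F x - f n x))\<^sup>2) \<partial>lborel) \<le> ennreal ((1/4)^n)" for n
  proof -
    have "(\<integral>\<^sup>+x. ennreal ((cmod (F x - f n x))\<^sup>2) \<partial>lborel)
        = (\<integral>\<^sup>+x. liminf (\<lambda>m. ennreal ((cmod (f m x - f n x))\<^sup>2)) \<partial>lborel)"
    proof (rule nn_integral_cong_AE, use conv in eventually_elim)
      fix x assume "(\<lambda>m. f m x) \<longlonglongrightarrow> F x"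
      then have "(\<lambda>m. ennreal ((cmod (f m x - f n x))\<^sup>2)) \<longlonglongrightarrow> ennreal ((cmod (F x - f n x))\<^sup>2)"
        by (intro tendsto_intros)
      then show "ennreal ((cmod (F x - f n x))\<^sup>2) = liminf (\<lambda>m. ennreal ((cmod (f m x - f n x))\<^sup>2))"
        by (rule lim_imp_Liminf[OF sequentially_bot, symmetric])
    qed
    also have "\<dots> \<le> liminf (\<lambda>m. \<integral>\<^sup>+x. ennreal ((cmod (f m x - f n x))\<^sup>2) \<partial>lborel)"
      by (rule nn_integral_liminf) measurable
    also have "\<dots> \<le> ennreal ((1/4)^n)"
      by (intro Liminf_le) (auto intro!: eventually_sequentiallyI[of n] le)
    finally show ?thesis .
  qed
  have sd: "sq_integrable (\<lambda>x. F x - f n x)" for n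
    unfolding sq_integrable_def
  proof
    have "(\<integral>\<^sup>+x. ennreal ((cmod (F x - f n x))\<^sup>2) \<partial>lborel) < \<infinity>"
      using fatou[of n] by (rule order.strict_trans1) simp
    then show "integrable lborel (\<lambda>x. (cmod (F x - f n x))\<^sup>2)"
      by (intro integrableI_bounded) auto
  qed measurable
  have sF: "sq_integrable F"
    using sq_integrable_add[OF sd sf, of 0 0] by simp
  have "(\<lambda>n. X (r n)) \<longlonglongrightarrow> L2 F"
  proof (rule Lim_null[THEN iffD2], rule Lim_null_comparison)
    show "\<forall>\<^sub>F n in sequentially. norm (X (r n) - L2 F) \<le> (1/2)^n"
    proof (rule always_eventually, rule allI)
      fix n
      have "ennreal ((norm (L2 F - X (r n)))\<^sup>2) \<le> ennreal ((1/4)^n)"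
        unfolding Xf L2_diff(1)[OF sF sf] using fatou[of n] by (simp add: power2_norm_L2[OF sd])
      then have "(norm (X (r n) - L2 F))\<^sup>2 \<le> ((1/2)^n)\<^sup>2"
        unfolding half_power_square by (simp add: norm_minus_commute)
      then show "norm (X (r n) - L2 F) \<le> (1/2)^n" by (rule power2_le_imp_le) simp
    qed
    show "(\<lambda>n. (1/2)^n :: real) \<longlonglongrightarrow> 0" by (intro LIMSEQ_realpow_zero) auto
  qed
  then have "(X \<circ> r) \<longlonglongrightarrow> L2 F" by (simp add: o_def)
  from Cauchy_converges_subseq[OF X r this] show "convergent X" by (auto simp: convergent_def)
qed

section \<open>Twisted translations on \<open>L\<^sup>1\<close>\<close>

text \<open>The bicharacter that is the cocycle of the twisted convolution.\<close>

definition twist :: "real \<Rightarrow> complex ^ 'n \<Rightarrow> complex ^ 'n \<Rightarrow> complex" where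
  "twist l z w = exp (\<i> * complex_of_real (l / 2 * Im (hdot z w)))"

lemma norm_twist [simp]: "cmod (twist l z w) = 1"
  by (simp add: twist_def)

lemma hdot_minus_left: "hdot (- z) w = - hdot z w"
  by (simp add: hdot_def sum_negf)

lemma hdot_swap: "hdot w z = cnj (hdot z w)"
  by (simp add: hdot_def mult.commute)

lemma twist_add_left: "twist l (z + z') w = twist l z w * twist l z' w"
  by (simp add: twist_def hdot_add_left distrib_left flip: exp_add)

lemma twist_swap: "twist l w z = cnj (twist l z w)"
  by (simp add: twist_def hdot_swap[of w z] exp_cnj)

lemma twist_add_right: "twist l z (w + w') = twist l z w * twist l z w'"
  by (simp add: twist_def hdot_add_right distrib_left flip: exp_add)

lemma twist_minus_left: "twist l (- z) w = cnj (twist l z w)"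
  by (simp add: twist_def hdot_minus_left exp_cnj)

lemma twist_minus_right: "twist l z (- w) = cnj (twist l z w)"
  by (metis twist_minus_left twist_swap)

lemma twist_cnj_cancel [simp]: "twist l z w * cnj (twist l z w) = 1"
  "cnj (twist l z w) * twist l z w = 1"
  using complex_norm_square[of "twist l z w"] by (simp_all add: mult.commute)

lemma twist_self [simp]: "twist l z z = 1"
proof -
  have "Im (hdot z z) = 0" by (simp add: hdot_def mult.commute)
  then show ?thesis by (simp add: twist_def)
qed

lemma twist_zero [simp]: "twist l 0 w = 1" "twist l z 0 = 1"
  by (simp_all add: twist_def hdot_def)

lemma continuous_on_twist [continuous_intros]:
  "continuous_on S f \<Longrightarrow> continuous_on S g \<Longrightarrow> continuous_on S (\<lambda>x. twist l (f x) (g x))"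
  unfolding twist_def hdot_def by (intro continuous_intros)

lemma tendsto_twist [tendsto_intros]:
  "(f \<longlongrightarrow> a) F \<Longrightarrow> (g \<longlongrightarrow> b) F \<Longrightarrow> ((\<lambda>x. twist l (f x) (g x)) \<longlongrightarrow> twist l a b) F"
  unfolding twist_def hdot_def by (intro tendsto_intros)

lemma borel_measurable_twist [measurable (raw)]:
  assumes "f \<in> borel_measurable M" "g \<in> borel_measurable M"
  shows "(\<lambda>x. twist l (f x) (g x)) \<in> borel_measurable M"
proof -
  have "(\<lambda>p. twist l (fst p) (snd p)) \<in> borel_measurable borel"
    by (intro borel_measurable_continuous_onI continuous_intros)
  from measurable_compose[OF borel_measurable_Pair[OF assms] this] show ?thesis by simp
qed

lemma integrable_borel_measurable:
  fixes f :: "'a::euclidean_space \<Rightarrow> complex"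
  shows "integrable lborel f \<Longrightarrow> f \<in> borel_measurable borel"
  using borel_measurable_integrable by fastforce

lemma integrable_twisted_shift:
  assumes "integrable lborel f"
  shows "integrable lborel (\<lambda>u. f (u - z) * twist l z u)"
proof (rule Bochner_Integration.integrable_bound)
  show i: "integrable lborel (\<lambda>u. f (u - z))"
    using integrable_lborel_affine_sign[of 1 f "- z"] assms by simp
  then show "(\<lambda>u. f (u - z) * twist l z u) \<in> borel_measurable lborel"
    using borel_measurable_integrable[OF i] by measurable
qed (simp add: norm_mult)

text \<open>Twisted translation: what convolving from the left with a point mass at \<open>z\<close> would be.  The phase
  is \<open>twist l u (u - z)\<close>, rewritten.\<close>

lift_definition twisted_shift :: "real \<Rightarrow> complex ^ 'n \<Rightarrow> (complex ^ 'n) L1 \<Rightarrow> (complex ^ 'n) L1"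
  is "\<lambda>l z f u. f (u - z) * twist l z u"
proof -
  fix l :: real and z and f f' :: "complex ^ 'n \<Rightarrow> complex"
  assume f: "L1_rel f f'"
  then have "AE u in lborel. f (- z + 1 *\<^sub>R u) = f' (- z + 1 *\<^sub>R u)"
    by (intro AE_lborel_affine_sign) (auto simp: L1_rel_def)
  then have "AE u in lborel. f (u - z) * twist l z u = f' (u - z) * twist l z u"
    by eventually_elim simp
  with f show "L1_rel (\<lambda>u. f (u - z) * twist l z u) (\<lambda>u. f' (u - z) * twist l z u)"
    by (simp add: L1_rel_def integrable_twisted_shift)
qed

lemma L1_rep_L1: "L1 (rep_L1 g) = g"
  using Quotient3_abs_rep[OF Quotient3_L1] .

lemma integrable_rep_L1: "integrable lborel (rep_L1 g)"
  using Quotient3_rep_reflp[OF Quotient3_L1, of g] by (simp add: L1_rel_def)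

lemma L1_cases:
  obtains f where "integrable lborel f" "g = L1 f"
  using integrable_rep_L1 L1_rep_L1 by metis

lemma L1_rel_refl: "integrable lborel f \<Longrightarrow> L1_rel f f"
  by (simp add: L1_rel_def)

lemma plus_L1: "integrable lborel f \<Longrightarrow> integrable lborel g \<Longrightarrow> L1 f + L1 g = L1 (\<lambda>x. f x + g x)"
  by (intro plus_L1.abs_eq L1_rel_refl)

lemma minus_L1: "integrable lborel f \<Longrightarrow> integrable lborel g \<Longrightarrow> L1 f - L1 g = L1 (\<lambda>x. f x - g x)"
  by (intro minus_L1.abs_eq L1_rel_refl)

lemma scaleC_L1: "integrable lborel f \<Longrightarrow> a *\<^sub>C L1 f = L1 (\<lambda>x. a * f x)"
  by (intro scaleC_L1.abs_eq L1_rel_refl)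

lemma norm_L1: "integrable lborel f \<Longrightarrow> norm (L1 f) = (\<integral>x. cmod (f x) \<partial>lborel)"
  by (intro norm_L1.abs_eq L1_rel_refl)

lemma twisted_shift_L1:
  "integrable lborel f \<Longrightarrow> twisted_shift l z (L1 f) = L1 (\<lambda>u. f (u - z) * twist l z u)"
  by (intro twisted_shift.abs_eq L1_rel_refl)

lemma twisted_conv_L1:
  "integrable lborel f \<Longrightarrow> integrable lborel g \<Longrightarrow>
    twisted_conv l (L1 f) (L1 g) = L1 (\<lambda>z. \<integral>w. f (z - w) * g w * twist l z w \<partial>lborel)"
  unfolding twist_def by (intro twisted_conv.abs_eq L1_rel_refl)

lemma integrable_twisted_conv:
  "integrable lborel f \<Longrightarrow> integrable lborel g \<Longrightarrow>
    integrable lborel (\<lambda>z. \<integral>w. f (z - w) * g w * twist l z w \<partial>lborel)"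
  using twisted_integrand_integrable[of f g l] by (simp add: twisted_integrand_def twist_def)

lemma L1_star_L1: "integrable lborel f \<Longrightarrow> L1_star (L1 f) = L1 (\<lambda>z. cnj (f (- z)))"
  by (intro L1_star.abs_eq L1_rel_refl)

lemma integrable_star:
  fixes f :: "complex ^ 'n \<Rightarrow> complex"
  shows "integrable lborel f \<Longrightarrow> integrable lborel (\<lambda>z. cnj (f (- z)))"
  using integrable_lborel_affine_sign[of "- 1" f 0] by simp

lemma norm_twisted_shift [simp]: "norm (twisted_shift l z g) = norm g"
proof -
  obtain f where f: "integrable lborel f" "g = L1 f" by (rule L1_cases)
  have "f \<in> borel_measurable borel" using f(1) by (rule integrable_borel_measurable)
  then have "(\<integral>u. cmod (f (- z + 1 *\<^sub>R u)) \<partial>lborel) = (\<integral>u. cmod (f u) \<partial>lborel)"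
    by (intro integral_lborel_affine_sign[where f = "\<lambda>u. cmod (f u)"]) auto
  then show ?thesis
    by (simp add: f twisted_shift_L1 norm_L1 integrable_twisted_shift norm_mult)
qed

lemma twisted_shift_diff: "twisted_shift l z (f - g) = twisted_shift l z f - twisted_shift l z g"
proof -
  obtain F G where "integrable lborel F" "f = L1 F" "integrable lborel G" "g = L1 G" by (metis L1_cases)
  then show ?thesis
    by (simp add: twisted_shift_L1 minus_L1 integrable_twisted_shift left_diff_distrib)
qed

lemma twisted_shift_scaleC: "twisted_shift l z (a *\<^sub>C f) = a *\<^sub>C twisted_shift l z f"
proof -
  obtain F where "integrable lborel F" "f = L1 F" by (rule L1_cases)
  then show ?thesis
    by (simp add: twisted_shift_L1 scaleC_L1 integrable_twisted_shift mult.assoc)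
qed

lemma twisted_shift_zero [simp]: "twisted_shift l 0 f = f"
proof -
  obtain F where "integrable lborel F" "f = L1 F" by (rule L1_cases)
  then show ?thesis by (simp add: twisted_shift_L1)
qed

text \<open>The translations form a projective representation with cocycle \<open>twist\<close>; this is where the
  Heisenberg group law comes from.\<close>

lemma twisted_shift_twisted_shift:
  "twisted_shift l z (twisted_shift l w f) = twist l z w *\<^sub>C twisted_shift l (z + w) f"
proof -
  obtain F where F: "integrable lborel F" "f = L1 F" by (rule L1_cases)
  have "F (u - z - w) * twist l w (u - z) * twist l z u = twist l z w * (F (u - (z + w)) * twist l (z + w) u)" for u
    using twist_add_right[of l w u "- z"]
    by (simp add: twist_add_left twist_minus_right twist_swap[of l w z] diff_diff_add)
  then show ?thesis
    by (simp add: F twisted_shift_L1 scaleC_L1 integrable_twisted_shift)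
qed

lemma twisted_shift_conv:
  "twisted_shift l z (twisted_conv l f g) = twisted_conv l (twisted_shift l z f) g"
proof -
  obtain F G where F: "integrable lborel F" "f = L1 F" and G: "integrable lborel G" "g = L1 G"
    by (metis L1_cases)
  have eq: "F (u - z - w) * G w * twist l (u - z) w * twist l z u
      = F (u - w - z) * twist l z (u - w) * G w * twist l u w" for u w
    using twist_add_left[of l u "- z" w] twist_add_right[of l z u "- w"]
    by (simp add: twist_minus_left twist_minus_right diff_diff_eq add.commute)
  have "(\<integral>w. F (u - z - w) * G w * twist l (u - z) w \<partial>lborel) * twist l z u
      = (\<integral>w. F (u - w - z) * twist l z (u - w) * G w * twist l u w \<partial>lborel)" for u
    by (simp only: integral_mult_left_zero[symmetric] eq)
  then show ?thesis
    by (simp add: F G twisted_shift_L1 twisted_conv_L1 integrable_twisted_shift integrable_twisted_conv)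
qed

text \<open>Translations are formally unitary: their effect cancels in \<open>g\<^sup>* * f\<close>.  The substitution
  \<open>w \<mapsto> w + z\<close> in the convolution integral removes the translation, and the phases combine
  to the cocycle of the convolution on the right.\<close>

lemma twisted_conv_star_shift:
  "twisted_conv l (L1_star (twisted_shift l z g)) (twisted_shift l z f) = twisted_conv l (L1_star g) f"
proof -
  obtain F G where F: "integrable lborel F" "f = L1 F" and G: "integrable lborel G" "g = L1 G"
    by (metis L1_cases)
  have [measurable]: "F \<in> borel_measurable borel" "G \<in> borel_measurable borel"
    using F G by (simp_all add: integrable_borel_measurable)
  have eq: "(\<integral>w. cnj (G (- (u - w) - z) * twist l z (- (u - w))) * (F (w - z) * twist l z w) * twist l u w \<partial>lborel)
      = (\<integral>w. cnj (G (- (u - w))) * F w * twist l u w \<partial>lborel)" (is "integral\<^sup>L _ ?A = integral\<^sup>L _ ?B") for u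
  proof -
    have "?A w = ?B (- z + 1 *\<^sub>R w)" for w
    proof -
      have "cnj (twist l z (- (u - w))) * (twist l z w * twist l u w) = twist l u (w - z)"
        using twist_add_right[of l z w "- u"] twist_add_right[of l u w "- z"] twist_swap[of l z u]
        by (simp add: twist_minus_right)
      moreover have eq: "w - u - z = w - z - u" by simp
      ultimately show ?thesis by (simp add: eq)
    qed
    then have "integral\<^sup>L lborel ?A = (\<integral>w. ?B (- z + 1 *\<^sub>R w) \<partial>lborel)"
      by (rule Bochner_Integration.integral_cong[OF refl])
    also have "\<dots> = integral\<^sup>L lborel ?B"
      by (intro integral_lborel_affine_sign) (auto, measurable)
    finally show ?thesis .
  qed
  show ?thesis
    unfolding F(2) G(2) twisted_shift_L1[OF F(1)] twisted_shift_L1[OF G(1)]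
      L1_star_L1[OF integrable_twisted_shift[OF G(1)]] L1_star_L1[OF G(1)]
      twisted_conv_L1[OF integrable_star[OF integrable_twisted_shift[OF G(1)]] integrable_twisted_shift[OF F(1)]]
      twisted_conv_L1[OF integrable_star[OF G(1)] F(1)]
    by (simp only: eq)
qed

section \<open>Convolution as an average of translates\<close>

text \<open>The convolution \<open>h * g\<close> is the average of the translates \<open>L\<^sub>z g\<close> with weights \<open>h z\<close>, so it is close to
  \<open>(\<integral> h) L\<^sub>a g\<close> if all these translates are close to \<open>L\<^sub>a g\<close>.  Fubini's theorem gives this without
  integrating an \<open>L\<^sup>1\<close>-valued function.\<close>

lemma norm_twisted_conv_minus_shift_le:
  fixes h :: "complex ^ 'n \<Rightarrow> complex"
  assumes h: "integrable lborel h"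
    and near: "\<And>z. h z \<noteq> 0 \<Longrightarrow> norm (twisted_shift l z g - twisted_shift l a g) \<le> e"
  shows "norm (twisted_conv l (L1 h) g - (\<integral>z. h z \<partial>lborel) *\<^sub>C twisted_shift l a g) \<le> e * norm (L1 h)"
proof -
  obtain f where f: "integrable lborel f" and g: "g = L1 f" by (rule L1_cases)
  have [measurable]: "f \<in> borel_measurable borel" "h \<in> borel_measurable borel"
    using f h by (simp_all add: integrable_borel_measurable)
  define G where "G z u = f (u - z) * twist l z u" for z u
  have iG: "integrable lborel (G z)" for z
    unfolding G_def by (rule integrable_twisted_shift[OF f])
  have [measurable]: "(\<lambda>p. G (fst p) (snd p)) \<in> borel_measurable (borel \<Otimes>\<^sub>M borel)"
    unfolding G_def by measurable
  have [measurable]: "G a \<in> borel_measurable borel"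
    unfolding G_def by measurable
  have shift: "twisted_shift l z g = L1 (G z)" for z
    unfolding g twisted_shift_L1[OF f] G_def ..
  define D where "D = (\<lambda>(z, u). h z * (G z u - G a u))"
  have mD[measurable]: "D \<in> borel_measurable (lborel \<Otimes>\<^sub>M lborel)"
    unfolding D_def case_prod_beta by measurable
  have sect: "integrable lborel (\<lambda>u. D (z, u))" for z
    unfolding D_def using iG by simp
  have nrm: "(\<integral>u. norm (D (z, u)) \<partial>lborel) \<le> e * cmod (h z)" for z
  proof (cases "h z = 0")
    case False
    have "(\<integral>u. norm (D (z, u)) \<partial>lborel) = cmod (h z) * norm (L1 (G z) - L1 (G a))"
      unfolding D_def by (simp add: norm_mult minus_L1 iG norm_L1)
    also have "\<dots> \<le> cmod (h z) * e"
      using near[OF False] by (intro mult_left_mono) (auto simp: shift)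
    finally show ?thesis by (simp add: mult.commute)
  qed (simp add: D_def)
  have inrm: "integrable lborel (\<lambda>z. \<integral>u. norm (D (z, u)) \<partial>lborel)"
  proof (rule Bochner_Integration.integrable_bound)
    show "integrable lborel (\<lambda>z. e * cmod (h z))" using h by simp
    show "AE z in lborel. norm (\<integral>u. norm (D (z, u)) \<partial>lborel) \<le> norm (e * cmod (h z))"
    proof (rule AE_I2)
      fix z
      have "0 \<le> (\<integral>u. norm (D (z, u)) \<partial>lborel)" by (rule Bochner_Integration.integral_nonneg) simp
      then show "norm (\<integral>u. norm (D (z, u)) \<partial>lborel) \<le> norm (e * cmod (h z))"
        using nrm[of z] by simp
    qed
  qed measurable
  have iD: "integrable (lborel \<Otimes>\<^sub>M lborel) D"
    by (rule lborel_pair.Fubini_integrable[OF mD inrm]) (simp add: sect)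
  have iD': "integrable (lborel \<Otimes>\<^sub>M lborel) (\<lambda>(z, u). D (z, u))"
    using iD by (simp add: case_prod_eta)
  have inD: "integrable (lborel \<Otimes>\<^sub>M lborel) (\<lambda>(z, u). norm (D (z, u)))"
  proof -
    have "(\<lambda>(z, u). norm (D (z, u))) = (\<lambda>p. norm (D p))" by (rule ext) (simp add: split_beta)
    then show ?thesis using integrable_norm[OF iD] by simp
  qed
  \<comment> \<open>The substitution \<open>w = u - z\<close> exhibits the convolution as an average of shifts of \<open>g\<close>.\<close>
  have sub: "(\<integral>w. h (u - w) * f w * twist l u w \<partial>lborel) = (\<integral>z. h z * G z u \<partial>lborel)" for u
  proof -
    have "h (u - w) * f w * twist l u w = h (u + (- 1) *\<^sub>R w) * G (u + (- 1) *\<^sub>R w) u" for w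
    proof -
      have "twist l (u - w) u = twist l u w"
        using twist_add_left[of l u "- w" u] by (simp add: twist_minus_left twist_swap[of l w u])
      then show ?thesis by (simp add: G_def)
    qed
    then have "(\<integral>w. h (u - w) * f w * twist l u w \<partial>lborel)
        = (\<integral>w. h (u + (- 1) *\<^sub>R w) * G (u + (- 1) *\<^sub>R w) u \<partial>lborel)"
      by (rule Bochner_Integration.integral_cong[OF refl])
    also have "\<dots> = (\<integral>z. h z * G z u \<partial>lborel)"
      unfolding G_def by (rule integral_lborel_affine_sign[where f = "\<lambda>z. h z * (f (u - z) * twist l z u)"]) (simp, measurable)
    finally show ?thesis .
  qed
  have avg: "AE u in lborel. (\<integral>w. h (u - w) * f w * twist l u w \<partial>lborel) - (\<integral>z. h z \<partial>lborel) * G a u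
      = (\<integral>z. D (z, u) \<partial>lborel)"
    using lborel_pair.AE_integrable_snd[OF iD']
  proof eventually_elim
    fix u assume i: "integrable lborel (\<lambda>z. D (z, u))"
    have "(\<integral>z. h z * G z u \<partial>lborel) = (\<integral>z. D (z, u) + h z * G a u \<partial>lborel)"
      by (rule Bochner_Integration.integral_cong[OF refl]) (simp add: D_def algebra_simps)
    also have "\<dots> = (\<integral>z. D (z, u) \<partial>lborel) + (\<integral>z. h z \<partial>lborel) * G a u"
      using i h by (subst Bochner_Integration.integral_add) auto
    finally show "(\<integral>w. h (u - w) * f w * twist l u w \<partial>lborel) - (\<integral>z. h z \<partial>lborel) * G a u
        = (\<integral>z. D (z, u) \<partial>lborel)" unfolding sub by simp
  qed
  have iconv: "integrable lborel (\<lambda>u. \<integral>w. h (u - w) * f w * twist l u w \<partial>lborel)"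
    by (rule integrable_twisted_conv[OF h f])
  have ih: "integrable lborel (\<lambda>u. (\<integral>z. h z \<partial>lborel) * G a u)"
    using iG by simp
  have "norm (twisted_conv l (L1 h) g - (\<integral>z. h z \<partial>lborel) *\<^sub>C twisted_shift l a g)
      = (\<integral>u. cmod ((\<integral>w. h (u - w) * f w * twist l u w \<partial>lborel) - (\<integral>z. h z \<partial>lborel) * G a u) \<partial>lborel)"
    unfolding shift scaleC_L1[OF iG]
    unfolding g twisted_conv_L1[OF h f] minus_L1[OF iconv ih]
    by (rule norm_L1[OF Bochner_Integration.integrable_diff[OF iconv ih]])
  also have "\<dots> = (\<integral>u. cmod (\<integral>z. D (z, u) \<partial>lborel) \<partial>lborel)"
    using avg borel_measurable_integrable[OF iconv] borel_measurable_integrable[OF ih]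
    by (intro integral_cong_AE) (measurable, auto elim: eventually_mono)
  also have "\<dots> \<le> (\<integral>u. (\<integral>z. norm (D (z, u)) \<partial>lborel) \<partial>lborel)"
    using lborel_pair.integrable_snd[OF iD'] lborel_pair.integrable_snd[OF inD]
    by (intro integral_mono integral_norm_bound integrable_norm)
  also have "\<dots> = (\<integral>z. (\<integral>u. norm (D (z, u)) \<partial>lborel) \<partial>lborel)"
    using lborel_pair.Fubini_integral[of "\<lambda>z u. norm (D (z, u))"] inD by simp
  also have "\<dots> \<le> (\<integral>z. e * cmod (h z) \<partial>lborel)"
    using inrm h nrm by (intro integral_mono) auto
  also have "\<dots> = e * norm (L1 h)" by (simp add: norm_L1 h)
  finally show ?thesis .
qed

section \<open>Strong continuity of twisted translations\<close>

lemma integrable_complex_indicator: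
  assumes "A \<in> sets M" "emeasure M A < \<infinity>"
  shows "integrable M (indicator A :: _ \<Rightarrow> complex)"
proof -
  have "integrable M (\<lambda>x. complex_of_real (indicator A x))"
    using assms by (intro integrable_of_real) simp
  then show ?thesis by (simp add: of_real_indicator)
qed

text \<open>Translates of the indicator of an open set converge pointwise on the set, but possibly not on its
  boundary, which may have positive measure.  Yet no mass can stay outside, since translation preserves
  the norm.  This is made precise by applying dominated convergence to
  \<open>\<bar>a\<^sub>k - b\<bar> - \<bar>a\<^sub>k\<bar>\<close>, which vanishes off the set and is bounded by \<open>\<bar>b\<bar>\<close>.\<close>

lemma tendsto_twisted_shift_open:
  fixes U :: "(complex ^ 'n) set"
  assumes U: "open U" "emeasure lborel U < \<infinity>" and w: "w \<longlonglongrightarrow> 0"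
  shows "(\<lambda>k. twisted_shift l (w k) (L1 (indicator U))) \<longlonglongrightarrow> L1 (indicator U)"
proof -
  have [measurable]: "U \<in> sets borel" using U(1) by simp
  define b where "b = (indicator U :: complex ^ 'n \<Rightarrow> complex)"
  have ib: "integrable lborel b"
    unfolding b_def using U(2) by (intro integrable_complex_indicator) auto
  define a where "a k u = b (u - w k) * twist l (w k) u" for k u
  have ia: "integrable lborel (a k)" for k
    unfolding a_def by (rule integrable_twisted_shift[OF ib])
  have na: "(\<integral>u. cmod (a k u) \<partial>lborel) = (\<integral>u. cmod (b u) \<partial>lborel)" for k
    using norm_twisted_shift[of l "w k" "L1 b"]
    by (simp add: twisted_shift_L1 norm_L1 ib integrable_twisted_shift a_def[symmetric] ia)
  have "(\<lambda>k. \<integral>u. cmod (a k u - b u) - cmod (a k u) \<partial>lborel) \<longlonglongrightarrow> (\<integral>u. - cmod (b u) \<partial>lborel)"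
  proof (rule integral_dominated_convergence[where w = "\<lambda>u. cmod (b u)"])
    show "AE u in lborel. (\<lambda>k. cmod (a k u - b u) - cmod (a k u)) \<longlonglongrightarrow> - cmod (b u)"
    proof (rule AE_I2)
      fix u
      show "(\<lambda>k. cmod (a k u - b u) - cmod (a k u)) \<longlonglongrightarrow> - cmod (b u)"
      proof (cases "u \<in> U")
        case True
        have "(\<lambda>k. u - w k) \<longlonglongrightarrow> u - 0" by (intro tendsto_intros w)
        then have "\<forall>\<^sub>F k in sequentially. u - w k \<in> U"
          using U(1) True by (intro topological_tendstoD) auto
        then have "\<forall>\<^sub>F k in sequentially. a k u = twist l (w k) u"
          by eventually_elim (simp add: a_def b_def)
        moreover have "(\<lambda>k. twist l (w k) u) \<longlonglongrightarrow> twist l 0 u" by (intro tendsto_intros w)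
        ultimately have a1: "(\<lambda>k. a k u) \<longlonglongrightarrow> 1" using tendsto_cong[of "\<lambda>k. a k u"] by force
        have "(\<lambda>k. cmod (a k u - b u) - cmod (a k u)) \<longlonglongrightarrow> cmod (1 - b u) - cmod 1"
          by (intro tendsto_intros a1)
        then show ?thesis using True by (simp add: b_def)
      qed (simp add: b_def)
    qed
    show "AE u in lborel. norm (cmod (a k u - b u) - cmod (a k u)) \<le> cmod (b u)" for k
      by (rule AE_I2) (use norm_triangle_ineq3[of "a k u - b u" "a k u" for u] in simp)
  qed (use ia ib borel_measurable_integrable in \<open>auto intro!: borel_measurable_diff borel_measurable_norm\<close>)
  then have "(\<lambda>k. (\<integral>u. cmod (a k u - b u) - cmod (a k u) \<partial>lborel) + (\<integral>u. cmod (b u) \<partial>lborel))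
      \<longlonglongrightarrow> (\<integral>u. - cmod (b u) \<partial>lborel) + (\<integral>u. cmod (b u) \<partial>lborel)"
    by (intro tendsto_intros)
  then have "(\<lambda>k. \<integral>u. cmod (a k u - b u) \<partial>lborel) \<longlonglongrightarrow> 0"
    using ia ib na by simp
  then have "(\<lambda>k. norm (twisted_shift l (w k) (L1 b) - L1 b)) \<longlonglongrightarrow> 0"
    by (simp add: twisted_shift_L1 ib minus_L1 integrable_twisted_shift norm_L1 a_def[symmetric] ia)
  then show ?thesis unfolding b_def[symmetric] by (simp add: tendsto_norm_zero_iff Lim_null[symmetric])
qed

text \<open>Integrable functions are limits of simple ones, and indicators are limits in \<open>L\<^sup>1\<close> of
  indicators of open sets by outer regularity.\<close>

lemma tendsto_twisted_shift_at_zero: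
  fixes g :: "(complex ^ 'n) L1"
  assumes w: "w \<longlonglongrightarrow> 0"
  shows "(\<lambda>k. twisted_shift l (w k) g) \<longlonglongrightarrow> g"
proof -
  define X where "X = {g. (\<lambda>k. twisted_shift l (w k) g) \<longlonglongrightarrow> g}"
  have "closed X"
    unfolding X_def by (rule closed_tendsto_self[where K = 1]) (simp_all add: twisted_shift_diff)
  then have lim: "s \<longlonglongrightarrow> x \<Longrightarrow> (\<And>i. s i \<in> X) \<Longrightarrow> x \<in> X" for s x
    using closed_sequentially by blast
  have ind: "L1 (indicator A) \<in> X" if A: "A \<in> sets borel" "emeasure lborel A < \<infinity>" for A :: "(complex ^ 'n) set"
  proof -
    have "\<exists>U. open U \<and> A \<subseteq> U \<and> emeasure lborel (U - A) < ennreal (1 / real (Suc n))" for n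
    proof -
      have "0 < 1 / real (Suc n)" by simp
      then obtain U where "open U" "A \<subseteq> U" "emeasure lborel (U - A) < ennreal (1 / real (Suc n))"
        by (rule outer_regular_lborel[OF A(1)])
      then show ?thesis by (intro exI[of _ U] conjI)
    qed
    then obtain U where U: "\<And>n. open (U n)" "\<And>n. A \<subseteq> U n"
        "\<And>n. emeasure lborel (U n - A) < ennreal (1 / real (Suc n))"
      by metis
    have fin: "emeasure lborel (U n) < \<infinity>" for n
    proof -
      have "emeasure lborel (U n) = emeasure lborel A + emeasure lborel (U n - A)"
        using A(1) U(1,2) by (subst plus_emeasure) (auto simp: Un_absorb1)
      also have "\<dots> < \<infinity>" using A(2) U(3)[of n] by (auto simp: less_top intro: order.strict_trans)
      finally show ?thesis .
    qed
    have i: "integrable lborel (indicator A :: _ \<Rightarrow> complex)"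
      "integrable lborel (indicator (U n) :: _ \<Rightarrow> complex)" for n
      using A U(1) fin by (auto intro!: integrable_complex_indicator)
    have "norm (L1 (indicator (U n)) - L1 (indicator A)) \<le> 1 / real (Suc n)" for n
    proof -
      have "norm (L1 (indicator (U n)) - L1 (indicator A)) = (\<integral>x. cmod (indicator (U n) x - indicator A x) \<partial>lborel)"
        using A U(1) fin by (simp add: minus_L1 norm_L1 i)
      also have "\<dots> = (\<integral>x. indicator (U n - A) x \<partial>lborel)"
        using U(2) by (intro Bochner_Integration.integral_cong) (auto simp: indicator_def)
      also have "\<dots> = measure lborel (U n - A)" by simp
      also have "\<dots> \<le> 1 / real (Suc n)"
        using U(3)[of n] by (simp add: measure_def enn2real_leI order.strict_implies_order)
      finally show ?thesis .
    qed
    then have "\<forall>n. norm (L1 (indicator (U n)) - L1 (indicator A)) \<le> 1 / real (Suc n)" by blast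
    then have "(\<lambda>n. L1 (indicator (U n)) - L1 (indicator A)) \<longlonglongrightarrow> 0"
      by (rule Lim_null_comparison[OF always_eventually LIMSEQ_Suc[OF lim_1_over_n]])
    then have "(\<lambda>n. L1 (indicator (U n))) \<longlonglongrightarrow> L1 (indicator A)"
      by (rule LIM_zero_cancel)
    then show ?thesis
      by (rule lim) (use tendsto_twisted_shift_open[OF U(1) fin w] in \<open>simp add: X_def\<close>)
  qed
  obtain f where f: "integrable lborel f" and g: "g = L1 f" by (rule L1_cases)
  from f have "L1 f \<in> X"
  proof induction
    case (base A c)
    have i: "integrable lborel (indicator A :: _ \<Rightarrow> complex)"
      using base by (intro integrable_complex_indicator) auto
    have "L1 (\<lambda>x. indicator A x *\<^sub>R c) = c *\<^sub>C L1 (indicator A)"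
      unfolding scaleC_L1[OF i] by (rule arg_cong[where f = L1]) (auto simp: indicator_def)
    then show ?case
      using ind[of A] base unfolding X_def
      by (auto simp: twisted_shift_scaleC intro!: tendsto_scaleC)
  next
    case (add f h)
    have shift_add: "twisted_shift l z (L1 f + L1 h) = twisted_shift l z (L1 f) + twisted_shift l z (L1 h)" for z
      using twisted_shift_diff[of l z "L1 f + L1 h" "L1 h"] by simp
    show ?case
      using add unfolding plus_L1[OF add.hyps(1,2), symmetric] X_def
      by (auto simp: shift_add intro!: tendsto_add)
  next
    case (lim f s)
    have "(\<lambda>i. \<integral>x. cmod (s i x - f x) \<partial>lborel) \<longlonglongrightarrow> (\<integral>x. 0 \<partial>(lborel :: (complex ^ 'n) measure))"
    proof (rule integral_dominated_convergence[where w = "\<lambda>x. 3 * cmod (f x)"])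
      show "AE x in lborel. (\<lambda>i. cmod (s i x - f x)) \<longlonglongrightarrow> 0"
        using lim.hyps(2) by (intro AE_I2 tendsto_norm_zero) (simp add: LIM_zero)
      show "AE x in lborel. norm (cmod (s i x - f x)) \<le> 3 * cmod (f x)" for i
      proof (rule AE_I2)
        fix x
        show "norm (cmod (s i x - f x)) \<le> 3 * cmod (f x)"
          using lim.hyps(3)[of x i] norm_triangle_ineq4[of "s i x" "f x"] by simp
      qed
    qed (use lim.hyps(1,4) borel_measurable_integrable in \<open>auto intro!: borel_measurable_diff borel_measurable_norm\<close>)
    then have "(\<lambda>i. norm (L1 (s i) - L1 f)) \<longlonglongrightarrow> 0"
      using lim.hyps(1,4) by (simp add: minus_L1 norm_L1)
    then have "(\<lambda>i. L1 (s i)) \<longlonglongrightarrow> L1 f" by (simp add: tendsto_norm_zero_iff Lim_null[symmetric])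
    then show ?case using lim.IH by (rule \<open>\<And>x s. s \<longlonglongrightarrow> x \<Longrightarrow> (\<And>i. s i \<in> X) \<Longrightarrow> x \<in> X\<close>)
  qed
  then show ?thesis by (simp add: g X_def)
qed

text \<open>The group law reduces continuity at \<open>a\<close> to continuity at zero, up to the phase \<open>twist l a (z - a)\<close>.\<close>

lemma continuous_on_twisted_shift:
  fixes g :: "(complex ^ 'n) L1"
  shows "continuous_on UNIV (\<lambda>z. twisted_shift l z g)"
  unfolding continuous_on_sequentially
proof (intro allI impI ballI, elim conjE)
  fix z and a :: "complex ^ 'n" assume z: "z \<longlonglongrightarrow> a"
  have w: "(\<lambda>k. z k - a) \<longlonglongrightarrow> 0" using z by (simp add: LIM_zero)
  have eq: "twisted_shift l (z k) g = cnj (twist l a (z k - a)) *\<^sub>C twisted_shift l a (twisted_shift l (z k - a) g)" for k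
    by (simp add: twisted_shift_twisted_shift scaleC_scaleC)
  have "(\<lambda>k. twisted_shift l a (twisted_shift l (z k - a) g)) \<longlonglongrightarrow> twisted_shift l a g"
  proof (rule Lim_null[THEN iffD2], rule Lim_null_comparison)
    show "\<forall>\<^sub>F k in sequentially. norm (twisted_shift l a (twisted_shift l (z k - a) g) - twisted_shift l a g)
        \<le> norm (twisted_shift l (z k - a) g - g)"
      by (simp add: twisted_shift_diff[symmetric])
    show "(\<lambda>k. norm (twisted_shift l (z k - a) g - g)) \<longlonglongrightarrow> 0"
      using tendsto_twisted_shift_at_zero[OF w, of l g] by (simp add: tendsto_norm_zero_iff Lim_null[symmetric])
  qed
  moreover have "(\<lambda>k. cnj (twist l a (z k - a))) \<longlonglongrightarrow> cnj (twist l a 0)"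
    by (intro tendsto_intros w)
  ultimately have "(\<lambda>k. twisted_shift l (z k) g) \<longlonglongrightarrow> cnj (twist l a 0) *\<^sub>C twisted_shift l a g"
    unfolding eq by (intro tendsto_scaleC)
  then show "((\<lambda>z. twisted_shift l z g) \<circ> z) \<longlonglongrightarrow> twisted_shift l a g" by (simp add: o_def)
qed

section \<open>Functionals on \<open>L\<^sup>1\<close> that are locally integration\<close>

text \<open>By Lindeloef's theorem, countably many of the neighbourhoods for a given \<open>e\<close> cover the space, even
  after shrinking them so that \<open>m\<close> varies by less than \<open>e\<close> from its value at the centre.  Cut \<open>f\<close> along
  the disjoint pieces that they generate: on each piece both sides are close to \<open>m a\<close> times the integral,
  and the errors add up to at most \<open>2 * e\<close> times the norm of \<open>f\<close>.\<close>

lemma L1_functional_eq_integral: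
  fixes \<phi> :: "'a::euclidean_space L1 \<Rightarrow> complex" and m :: "'a \<Rightarrow> complex"
  assumes add: "\<And>f g. \<phi> (f + g) = \<phi> f + \<phi> g" and bd: "\<And>f. cmod (\<phi> f) \<le> C * norm f"
    and m: "continuous_on UNIV m" and mB: "\<And>z. cmod (m z) \<le> B"
    and loc: "\<And>a e. 0 < e \<Longrightarrow> \<exists>U. open U \<and> a \<in> U \<and>
      (\<forall>h. integrable lborel h \<longrightarrow> (\<forall>z. h z \<noteq> 0 \<longrightarrow> z \<in> U) \<longrightarrow>
        cmod (\<phi> (L1 h) - m a * (\<integral>z. h z \<partial>lborel)) \<le> e * norm (L1 h))"
    and f: "integrable lborel f"
  shows "\<phi> (L1 f) = (\<integral>z. f z * m z \<partial>lborel)"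
proof -
  have mm[measurable]: "m \<in> borel_measurable borel"
    by (intro borel_measurable_continuous_onI m)
  have im: "integrable lborel (\<lambda>z. h z * m z)" if h: "integrable lborel h" for h
  proof (rule Bochner_Integration.integrable_bound)
    show "integrable lborel (\<lambda>z. B * cmod (h z))" using h by simp
    show "(\<lambda>z. h z * m z) \<in> borel_measurable lborel"
      using borel_measurable_integrable[OF h] by measurable
    show "AE z in lborel. cmod (h z * m z) \<le> norm (B * cmod (h z))"
    proof (rule AE_I2)
      fix z
      have "cmod (m z) \<le> \<bar>B\<bar>" using mB[of z] by simp
      from mult_left_mono[OF this norm_ge_zero[of "h z"]]
      show "cmod (h z * m z) \<le> norm (B * cmod (h z))" by (simp add: norm_mult abs_mult mult.commute)
    qed
  qed
  define E where "E h = \<phi> (L1 h) - (\<integral>z. h z * m z \<partial>lborel)" for h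
  have E_add: "E (\<lambda>z. h z + k z) = E h + E k" if "integrable lborel h" "integrable lborel k" for h k
  proof -
    have "\<phi> (L1 (\<lambda>z. h z + k z)) = \<phi> (L1 h) + \<phi> (L1 k)"
      using that by (simp add: plus_L1[symmetric] add)
    moreover have "(\<integral>z. (h z + k z) * m z \<partial>lborel) = (\<integral>z. h z * m z \<partial>lborel) + (\<integral>z. k z * m z \<partial>lborel)"
      using im[OF that(1)] im[OF that(2)] by (simp add: distrib_right)
    ultimately show ?thesis by (simp add: E_def)
  qed
  have E_bd: "cmod (E h) \<le> (C + B) * (\<integral>z. cmod (h z) \<partial>lborel)" if h: "integrable lborel h" for h
  proof -
    have "cmod (\<integral>z. h z * m z \<partial>lborel) \<le> (\<integral>z. cmod (h z * m z) \<partial>lborel)"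
      by (rule integral_norm_bound)
    also have "\<dots> \<le> (\<integral>z. B * cmod (h z) \<partial>lborel)"
      using integrable_norm[OF im[OF h], unfolded norm_mult] h mB
      by (intro integral_mono) (auto simp: norm_mult mult.commute[of B] intro!: mult_left_mono)
    also have "\<dots> = B * (\<integral>z. cmod (h z) \<partial>lborel)" by simp
    finally show ?thesis
      using bd[of "L1 h"] norm_triangle_ineq4[of "\<phi> (L1 h)" "\<integral>z. h z * m z \<partial>lborel"]
      by (simp add: E_def norm_L1 h algebra_simps)
  qed
  have E_le: "cmod (E f) \<le> 2 * e * (\<integral>z. cmod (f z) \<partial>lborel)" if e: "0 < e" for e
  proof -
    have "\<exists>V. open V \<and> a \<in> V \<and> (\<forall>h. integrable lborel h \<longrightarrow> (\<forall>z. h z \<noteq> 0 \<longrightarrow> z \<in> V) \<longrightarrow>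
        cmod (E h) \<le> 2 * e * (\<integral>z. cmod (h z) \<partial>lborel))" for a
    proof -
      obtain U where U: "open U" "a \<in> U" and Uh: "\<And>h. integrable lborel h \<Longrightarrow> (\<And>z. h z \<noteq> 0 \<Longrightarrow> z \<in> U) \<Longrightarrow>
          cmod (\<phi> (L1 h) - m a * (\<integral>z. h z \<partial>lborel)) \<le> e * norm (L1 h)"
        using loc[OF e, of a] by blast
      define V where "V = U \<inter> m -` ball (m a) e"
      have "open V"
        unfolding V_def using m U(1) by (intro open_Int open_vimage) auto
      moreover have "a \<in> V" using U e by (simp add: V_def)
      moreover have "cmod (E h) \<le> 2 * e * (\<integral>z. cmod (h z) \<partial>lborel)"
        if h: "integrable lborel h" and hV: "\<And>z. h z \<noteq> 0 \<Longrightarrow> z \<in> V" for h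
      proof -
        have "cmod (m a * (\<integral>z. h z \<partial>lborel) - (\<integral>z. h z * m z \<partial>lborel))
            = cmod (\<integral>z. h z * (m a - m z) \<partial>lborel)"
          using im[OF h] h by (simp add: right_diff_distrib mult.commute)
        also have "\<dots> \<le> (\<integral>z. cmod (h z * (m a - m z)) \<partial>lborel)"
          by (rule integral_norm_bound)
        also have "\<dots> \<le> (\<integral>z. e * cmod (h z) \<partial>lborel)"
        proof (rule integral_mono)
          show "integrable lborel (\<lambda>z. cmod (h z * (m a - m z)))"
            using im[OF h] h by (intro integrable_norm) (simp add: right_diff_distrib)
          fix z
          show "cmod (h z * (m a - m z)) \<le> e * cmod (h z)"
          proof (cases "h z = 0")
            case False
            then have "cmod (m a - m z) \<le> e" using hV[of z] by (simp add: V_def dist_norm)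
            from mult_right_mono[OF this norm_ge_zero[of "h z"]]
            show ?thesis by (simp add: norm_mult mult.commute)
          qed simp
        qed (use h in simp)
        finally have "cmod (m a * (\<integral>z. h z \<partial>lborel) - (\<integral>z. h z * m z \<partial>lborel)) \<le> e * (\<integral>z. cmod (h z) \<partial>lborel)"
          by simp
        moreover have "cmod (\<phi> (L1 h) - m a * (\<integral>z. h z \<partial>lborel)) \<le> e * (\<integral>z. cmod (h z) \<partial>lborel)"
          using Uh[OF h] hV by (simp add: V_def norm_L1 h)
        ultimately show ?thesis
          using norm_triangle_ineq[of "\<phi> (L1 h) - m a * (\<integral>z. h z \<partial>lborel)"
              "m a * (\<integral>z. h z \<partial>lborel) - (\<integral>z. h z * m z \<partial>lborel)"]
          by (simp add: E_def)
      qed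
      ultimately show ?thesis by blast
    qed
    then obtain V where V: "\<And>a. open (V a)" "\<And>a. a \<in> V a" and Vh: "\<And>a h. integrable lborel h \<Longrightarrow>
        (\<And>z. h z \<noteq> 0 \<Longrightarrow> z \<in> V a) \<Longrightarrow> cmod (E h) \<le> 2 * e * (\<integral>z. cmod (h z) \<partial>lborel)"
      by metis
    obtain \<V> where \<V>: "\<V> \<subseteq> range V" "countable \<V>" "\<Union>\<V> = \<Union>(range V)"
      using Lindelof[of "range V"] V(1) by auto
    have UV: "\<Union>\<V> = UNIV" using \<V>(3) V(2) by auto
    then have "\<V> \<noteq> {}" by auto
    define A where "A = from_nat_into \<V>"
    have rA: "range A = \<V>" unfolding A_def using \<open>\<V> \<noteq> {}\<close> \<V>(2) by (rule range_from_nat_into)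
    have [measurable]: "A n \<in> sets borel" for n
      using rA \<V>(1) V(1) by (metis borel_open rangeI rangeE subsetD)
    \<comment> \<open>\<open>A n - S n\<close> are the disjoint pieces of the partition.\<close>
    define S where "S n = (\<Union>k<n. A k)" for n
    have S[measurable]: "S n \<in> sets borel" for n unfolding S_def by measurable
    have i: "integrable lborel (\<lambda>z. f z * indicator X z)" if "X \<in> sets borel" for X
    proof -
      have "(\<lambda>z. indicator X z *\<^sub>R f z) = (\<lambda>z. f z * indicator X z)"
        by (auto simp: indicator_def)
      then show ?thesis using integrable_mult_indicator[OF _ f, of X] that by simp
    qed
    have step: "cmod (E (\<lambda>z. f z * indicator (S n) z)) \<le> 2 * e * (\<integral>z. cmod (f z * indicator (S n) z) \<partial>lborel)" for n
    proof (induction n)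
      case 0
      then show ?case using E_bd[of "\<lambda>_. 0"] by (simp add: S_def)
    next
      case (Suc n)
      define X where "X = A n - S n"
      have X[measurable]: "X \<in> sets borel" unfolding X_def by measurable
      have ind: "indicator (S (Suc n)) z = (indicator (S n) z + indicator X z :: complex)" for z
        by (auto simp: S_def X_def indicator_def less_Suc_eq)
      have nind: "cmod (f z * (indicator (S n) z + indicator X z)) = cmod (f z * indicator (S n) z) + cmod (f z * indicator X z)" for z
        by (auto simp: X_def indicator_def)
      obtain a where "A n = V a" using rA \<V>(1) by (metis rangeE rangeI subsetD)
      then have "cmod (E (\<lambda>z. f z * indicator X z)) \<le> 2 * e * (\<integral>z. cmod (f z * indicator X z) \<partial>lborel)"
        by (intro Vh[of _ a] i X) (auto simp: X_def indicator_def split: if_splits)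
      moreover have "E (\<lambda>z. f z * indicator (S (Suc n)) z) = E (\<lambda>z. f z * indicator (S n) z) + E (\<lambda>z. f z * indicator X z)"
        unfolding ind distrib_left by (intro E_add i S X)
      moreover have "(\<integral>z. cmod (f z * indicator (S (Suc n)) z) \<partial>lborel)
          = (\<integral>z. cmod (f z * indicator (S n) z) \<partial>lborel) + (\<integral>z. cmod (f z * indicator X z) \<partial>lborel)"
        unfolding ind nind by (intro Bochner_Integration.integral_add integrable_norm i S X)
      ultimately show ?case
        using Suc.IH norm_triangle_ineq[of "E (\<lambda>z. f z * indicator (S n) z)" "E (\<lambda>z. f z * indicator X z)"]
        by (simp add: distrib_left)
    qed
    \<comment> \<open>What the first \<open>n\<close> pieces miss is controlled by the boundedness of \<open>E\<close> and tends to zero.\<close>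
    have le: "cmod (E f) \<le> 2 * e * (\<integral>z. cmod (f z) \<partial>lborel) + (C + B) * (\<integral>z. cmod (f z * indicator (- S n) z) \<partial>lborel)" for n
    proof -
      have "E (\<lambda>z. f z * indicator (S n) z + f z * indicator (- S n) z)
          = E (\<lambda>z. f z * indicator (S n) z) + E (\<lambda>z. f z * indicator (- S n) z)"
        by (intro E_add i) measurable
      moreover have "(\<lambda>z. f z * indicator (S n) z + f z * indicator (- S n) z) = f"
        by (auto simp: indicator_def)
      moreover have "(\<integral>z. cmod (f z * indicator (S n) z) \<partial>lborel) \<le> (\<integral>z. cmod (f z) \<partial>lborel)"
        using i[OF S] f by (intro integral_mono integrable_norm) (auto simp: indicator_def)
      then have "2 * e * (\<integral>z. cmod (f z * indicator (S n) z) \<partial>lborel) \<le> 2 * e * (\<integral>z. cmod (f z) \<partial>lborel)"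
        using e by (intro mult_left_mono) auto
      moreover have "cmod (E (\<lambda>z. f z * indicator (- S n) z)) \<le> (C + B) * (\<integral>z. cmod (f z * indicator (- S n) z) \<partial>lborel)"
        by (intro E_bd i) measurable
      ultimately show ?thesis
        using step[of n] norm_triangle_ineq[of "E (\<lambda>z. f z * indicator (S n) z)" "E (\<lambda>z. f z * indicator (- S n) z)"]
        by simp
    qed
    have "(\<lambda>n. \<integral>z. cmod (f z * indicator (- S n) z) \<partial>lborel) \<longlonglongrightarrow> (\<integral>z. 0 \<partial>(lborel :: 'a measure))"
    proof (rule integral_dominated_convergence[where w = "\<lambda>z. cmod (f z)"])
      show "AE z in lborel. (\<lambda>n. cmod (f z * indicator (- S n) z)) \<longlonglongrightarrow> 0"
      proof (rule AE_I2)
        fix z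
        obtain k where "z \<in> A k" using UV rA by blast
        then have "\<forall>\<^sub>F n in sequentially. cmod (f z * indicator (- S n) z) = 0"
          by (intro eventually_sequentiallyI[of "Suc k"]) (auto simp: S_def indicator_def Suc_le_eq)
        then show "(\<lambda>n. cmod (f z * indicator (- S n) z)) \<longlonglongrightarrow> 0"
          by (rule tendsto_eventually)
      qed
      show "(\<lambda>z. cmod (f z * indicator (- S n) z)) \<in> borel_measurable lborel" for n
        using borel_measurable_integrable[OF i[of "- S n"]] by measurable
    qed (use f in \<open>auto simp: indicator_def\<close>)
    then have "(\<lambda>n. 2 * e * (\<integral>z. cmod (f z) \<partial>lborel) + (C + B) * (\<integral>z. cmod (f z * indicator (- S n) z) \<partial>lborel))
        \<longlonglongrightarrow> 2 * e * (\<integral>z. cmod (f z) \<partial>lborel) + (C + B) * (\<integral>z. 0 \<partial>(lborel :: 'a measure))"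
      by (intro tendsto_intros)
    then show ?thesis
      using le by (intro LIMSEQ_le_const[where X = "\<lambda>n. 2 * e * (\<integral>z. cmod (f z) \<partial>lborel)
          + (C + B) * (\<integral>z. cmod (f z * indicator (- S n) z) \<partial>lborel)"]) auto
  qed
  have "cmod (E f) \<le> 0"
  proof (rule field_le_epsilon)
    fix d :: real assume d: "0 < d"
    define I where "I = (\<integral>z. cmod (f z) \<partial>lborel)"
    have I: "0 \<le> I" by (simp add: I_def)
    have "cmod (E f) \<le> 2 * (d / (2 * (I + 1))) * I"
      unfolding I_def by (rule E_le) (use d I in \<open>simp add: I_def[symmetric]\<close>)
    also have "\<dots> = d * (I / (I + 1))" using I by (simp add: field_simps)
    also have "\<dots> \<le> d * 1" using I d by (intro mult_left_mono) auto
    finally show "cmod (E f) \<le> 0 + d" by simp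
  qed
  then show ?thesis by (simp add: E_def)
qed

section \<open>An approximate identity\<close>

definition bump :: "nat \<Rightarrow> complex ^ 'n \<Rightarrow> complex" where
  "bump n z = indicator (ball 0 (1 / real (Suc n))) z / complex_of_real (measure lborel (ball (0 :: complex ^ 'n) (1 / real (Suc n))))"

lemma integrable_bump: "integrable lborel (bump n :: complex ^ 'n \<Rightarrow> complex)"
  unfolding bump_def [abs_def]
  by (intro integrable_divide integrable_complex_indicator emeasure_lborel_ball_finite) auto

lemma integral_bump: "(\<integral>z. bump n (z :: complex ^ 'n) \<partial>lborel) = 1"
  and norm_bump: "norm (L1 (bump n :: complex ^ 'n \<Rightarrow> complex)) = 1"
proof -
  define B where "B = ball (0 :: complex ^ 'n) (1 / real (Suc n))"
  have fin: "emeasure lborel B < \<infinity>" unfolding B_def by (rule emeasure_lborel_ball_finite)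
  have [measurable]: "B \<in> sets borel" by (simp add: B_def)
  have pos: "0 < measure lborel B" unfolding B_def by (rule content_ball_pos) simp
  have "(\<integral>z. complex_of_real (indicator B z) \<partial>lborel) = complex_of_real (measure lborel B)"
    by (subst integral_complex_of_real) simp
  then show "(\<integral>z. bump n (z :: complex ^ 'n) \<partial>lborel) = 1"
    unfolding bump_def B_def[symmetric] using pos by (simp add: of_real_indicator)
  have "(\<integral>z. cmod (bump n (z :: complex ^ 'n)) \<partial>lborel) = (\<integral>z. indicator B z / measure lborel B \<partial>lborel)"
    unfolding bump_def B_def[symmetric] using pos
    by (intro Bochner_Integration.integral_cong) (auto simp: norm_divide indicator_def)
  also have "\<dots> = 1" using pos by simp
  finally show "norm (L1 (bump n :: complex ^ 'n \<Rightarrow> complex)) = 1"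
    by (simp add: norm_L1 integrable_bump)
qed

text \<open>The functions \<open>bump n\<close> form an approximate identity: averaging the translates of \<open>g\<close> over a small
  ball around zero changes \<open>g\<close> only a little.\<close>

lemma tendsto_twisted_conv_bump:
  fixes g :: "(complex ^ 'n) L1"
  shows "(\<lambda>n. twisted_conv l (L1 (bump n)) g) \<longlonglongrightarrow> g"
proof (rule LIMSEQ_I)
  fix e :: real assume e: "0 < e"
  have "continuous (at 0) (\<lambda>z. twisted_shift l z g)"
    using continuous_on_twisted_shift[of l g] by (simp add: continuous_on_eq_continuous_at)
  then obtain d where d: "0 < d"
    "\<And>z. dist z 0 < d \<Longrightarrow> dist (twisted_shift l z g) (twisted_shift l 0 g) < e / 2"
    unfolding continuous_at_eps_delta using e by (metis half_gt_zero)
  obtain N where N: "1 / real (Suc N) < d" using d(1) nat_approx_posE by blast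
  have "norm (twisted_conv l (L1 (bump n)) g - g) < e" if n: "N \<le> n" for n
  proof -
    have "1 / real (Suc n) \<le> 1 / real (Suc N)" using n by (simp add: frac_le)
    then have "norm (twisted_shift l z g - twisted_shift l 0 g) \<le> e / 2" if "bump n z \<noteq> 0" for z
      using that N d(2)[of z] by (auto simp: bump_def indicator_def dist_norm split: if_splits)
    from norm_twisted_conv_minus_shift_le[OF integrable_bump this]
    have "norm (twisted_conv l (L1 (bump n)) g - g) \<le> e / 2"
      by (simp add: integral_bump norm_bump)
    then show ?thesis using e by simp
  qed
  then show "\<exists>N. \<forall>n\<ge>N. norm (twisted_conv l (L1 (bump n)) g - g) < e" by blast
qed

section \<open>The representation on the essential subspace\<close>

locale twisted_star_hom =
  fixes l :: real
    and T :: "(complex ^ 'n) L1 \<Rightarrow> 'h::{complex_inner, complete_space} \<Rightarrow>\<^sub>L 'h"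
  assumes ops: "T f \<in> bounded_operators"
    and clin: "clinear_map T"
    and cont: "continuous_on UNIV T"
    and conv: "T (twisted_conv l f g) = T f o\<^sub>L T g"
    and star: "is_adjoint (T (L1_star f)) (T f)"
begin

lemma T_add: "T (f + g) = T f + T g"
  using clin by (simp add: clinear_map_def)

lemma T_scaleC: "T (a *\<^sub>C f) = a *\<^sub>C T f"
  using clin by (simp add: clinear_map_def)

lemma T_apply_scaleC: "T f (a *\<^sub>C u) = a *\<^sub>C T f u"
  using ops[of f] by (simp add: bounded_operators_def clinear_map_def)

lemma T_conv_apply: "T (twisted_conv l f g) u = T f (T g u)"
  by (simp add: conv)

text \<open>Continuity at zero, rescaled.  It bounds \<open>T\<close> by its operator norm \<open>onorm T\<close>.\<close>

lemma bounded_linear_T: "bounded_linear T"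
proof -
  have scaleR: "T (r *\<^sub>R f) = r *\<^sub>R T f" for r f
    using T_scaleC[of "complex_of_real r" f] by (simp add: scaleC_of_real)
  have "T 0 = 0" using T_add[of 0 0] by simp
  moreover have "continuous (at 0) T" using cont by (simp add: continuous_on_eq_continuous_at)
  ultimately obtain d where d: "0 < d" "\<And>f. norm f < d \<Longrightarrow> norm (T f) < 1"
    unfolding continuous_at_eps_delta dist_norm by (metis diff_zero zero_less_one)
  have "norm (T f) \<le> norm f * (2 / d)" for f
  proof (cases "f = 0")
    case False
    define r where "r = d / (2 * norm f)"
    have r: "0 < r" "norm (r *\<^sub>R f) < d" using False d(1) by (simp_all add: r_def)
    have "r * norm (T f) < 1" using d(2)[OF r(2)] r(1) by (simp add: scaleR)
    then show ?thesis using False d(1) by (simp add: r_def field_simps)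
  qed (simp add: \<open>T 0 = 0\<close>)
  then show ?thesis by (intro bounded_linear_intro[where K = "2 / d"] T_add scaleR)
qed

lemma T_diff: "T (f - g) = T f - T g"
  using bounded_linear_T by (simp add: bounded_linear.linear linear_diff)

lemma norm_T_apply_le: "norm (T f u) \<le> onorm T * norm f * norm u"
  using norm_blinfun[of "T f" u] mult_right_mono[OF onorm[OF bounded_linear_T, of f] norm_ge_zero[of u]]
  by linarith

lemma onorm_T_nonneg: "0 \<le> onorm T"
  by (rule onorm_pos_le[OF bounded_linear_T])

lemma tendsto_T_apply: "(f \<longlongrightarrow> g) F \<Longrightarrow> ((\<lambda>x. T (f x) u) \<longlongrightarrow> T g u) F"
  by (intro blinfun.tendsto tendsto_const bounded_linear.tendsto[OF bounded_linear_T])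

lemma cinner_T: "cinner (T f u) v = cinner u (T (L1_star f) v)"
  using star[of f] by (simp add: is_adjoint_def)

text \<open>The source of unitarity: both sides are \<open>\<langle>u, T (b) v\<rangle>\<close> for the same element \<open>b\<close> of the convolution
  algebra.\<close>

lemma cinner_T_shift:
  "cinner (T (twisted_shift l z f) u) (T (twisted_shift l z g) v) = cinner (T f u) (T g v)"
proof -
  have *: "cinner (T a u) (T b v) = cinner u (T (twisted_conv l (L1_star a) b) v)" for a b
    by (simp add: cinner_T T_conv_apply)
  show ?thesis unfolding * twisted_conv_star_shift ..
qed

lemma norm_T_shift: "norm (T (twisted_shift l z f) u) = norm (T f u)"
  using cinner_T_shift[of z f u f u] unfolding cinner_self of_real_eq_iff by (simp add: power2_eq_iff_nonneg)

text \<open>The essential subspace.  It is the closed span of the ranges of all \<open>T f\<close>, described through the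
  approximate identity so that the limits taken below exist by definition.\<close>

definition essential :: "'h set" where
  "essential = {u. (\<lambda>n. T (L1 (bump n)) u) \<longlonglongrightarrow> u}"

lemma essential_lim: "u \<in> essential \<Longrightarrow> (\<lambda>n. T (L1 (bump n)) u) \<longlonglongrightarrow> u"
  by (simp add: essential_def)

lemma closed_csubspace_essential: "closed_csubspace essential"
  unfolding closed_csubspace_def
proof (intro conjI ballI allI)
  show "closed essential"
    unfolding essential_def
    by (rule closed_tendsto_self[where K = "onorm T"])
      (use norm_T_apply_le[of "L1 (bump n)" for n] in \<open>simp_all add: blinfun.diff_right norm_bump\<close>)
qed (auto simp: essential_def blinfun.add_right T_apply_scaleC intro: tendsto_add tendsto_scaleC)

lemma T_in_essential: "T f u \<in> essential"
proof -
  have "(\<lambda>n. T (twisted_conv l (L1 (bump n)) f) u) \<longlonglongrightarrow> T f u"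
    by (intro tendsto_T_apply tendsto_twisted_conv_bump)
  then show ?thesis by (simp add: essential_def T_conv_apply)
qed

lemma essential_closed: "closed essential"
  using closed_csubspace_essential by (simp add: closed_csubspace_def)

text \<open>Only meaningful on \<open>essential\<close>, where the limit exists.\<close>

definition rep :: "complex ^ 'n \<Rightarrow> 'h \<Rightarrow> 'h" where
  "rep z u = lim (\<lambda>n. T (twisted_shift l z (L1 (bump n))) u)"

text \<open>By unitarity the sequence has the same mutual distances as \<open>T (L1 (bump n)) u\<close>, which converges.\<close>

lemma rep_lim:
  assumes u: "u \<in> essential"
  shows "(\<lambda>n. T (twisted_shift l z (L1 (bump n))) u) \<longlonglongrightarrow> rep z u"
proof -
  have "norm (T (twisted_shift l z (L1 (bump m))) u - T (twisted_shift l z (L1 (bump n))) u)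
      = norm (T (L1 (bump m)) u - T (L1 (bump n)) u)" for m n
    using norm_T_shift[of z "L1 (bump m) - L1 (bump n)" u]
    by (simp add: twisted_shift_diff T_diff blinfun.diff_left)
  then have "Cauchy (\<lambda>n. T (twisted_shift l z (L1 (bump n))) u)"
    using LIMSEQ_imp_Cauchy[OF essential_lim[OF u]] by (simp add: Cauchy_def dist_norm)
  then show ?thesis
    unfolding rep_def by (simp add: Cauchy_convergent_iff convergent_LIMSEQ_iff)
qed

lemma rep_eqI:
  "u \<in> essential \<Longrightarrow> (\<lambda>n. T (twisted_shift l z (L1 (bump n))) u) \<longlonglongrightarrow> w \<Longrightarrow> rep z u = w"
  using rep_lim LIMSEQ_unique by blast

lemma rep_in_essential: "u \<in> essential \<Longrightarrow> rep z u \<in> essential"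
  using closed_sequentially[OF essential_closed _ rep_lim] T_in_essential by blast

lemma rep_add: "u \<in> essential \<Longrightarrow> v \<in> essential \<Longrightarrow> rep z (u + v) = rep z u + rep z v"
  using closed_csubspace_essential
  by (intro rep_eqI) (auto simp: closed_csubspace_def blinfun.add_right intro: tendsto_add rep_lim)

lemma rep_scaleC: "u \<in> essential \<Longrightarrow> rep z (a *\<^sub>C u) = a *\<^sub>C rep z u"
  using closed_csubspace_essential
  by (intro rep_eqI) (auto simp: closed_csubspace_def T_apply_scaleC intro: tendsto_scaleC rep_lim)

lemma rep_diff: "u \<in> essential \<Longrightarrow> v \<in> essential \<Longrightarrow> rep z (u - v) = rep z u - rep z v"
  using closed_csubspace_essential
  by (intro rep_eqI) (auto simp: diff_closed_csubspace blinfun.diff_right intro: tendsto_diff rep_lim)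

lemma cinner_rep: 
  assumes "u \<in> essential" "v \<in> essential"
  shows "cinner (rep z u) (rep z v) = cinner u v"
proof (rule LIMSEQ_unique)
  show "(\<lambda>n. cinner (T (twisted_shift l z (L1 (bump n))) u) (T (twisted_shift l z (L1 (bump n))) v))
      \<longlonglongrightarrow> cinner (rep z u) (rep z v)"
    using assms by (intro tendsto_cinner rep_lim)
  show "(\<lambda>n. cinner (T (twisted_shift l z (L1 (bump n))) u) (T (twisted_shift l z (L1 (bump n))) v))
      \<longlonglongrightarrow> cinner u v"
    unfolding cinner_T_shift using assms by (intro tendsto_cinner essential_lim)
qed

lemma norm_rep: "u \<in> essential \<Longrightarrow> norm (rep z u) = norm u"
  using cinner_rep[of u u z] unfolding cinner_self of_real_eq_iff by (simp add: power2_eq_iff_nonneg)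

text \<open>The intertwining relation, which determines \<open>rep\<close> on the dense subspace spanned by the vectors
  \<open>T f u\<close> and transports the properties of the translations.\<close>

lemma rep_T: "rep z (T f u) = T (twisted_shift l z f) u"
proof (rule rep_eqI[OF T_in_essential])
  have "(\<lambda>n. T (twisted_conv l (L1 (bump n)) f - f) u) \<longlonglongrightarrow> T (f - f) u"
    by (intro tendsto_T_apply tendsto_diff tendsto_twisted_conv_bump tendsto_const)
  then have "(\<lambda>n. norm (T (twisted_conv l (L1 (bump n)) f - f) u)) \<longlonglongrightarrow> 0"
    using T_diff[of f f] by (simp add: tendsto_norm_zero)
  then have "(\<lambda>n. norm (T (twisted_shift l z (L1 (bump n))) (T f u) - T (twisted_shift l z f) u)) \<longlonglongrightarrow> 0"
    unfolding T_conv_apply[symmetric] twisted_shift_conv[symmetric]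
      blinfun.diff_left[symmetric] T_diff[symmetric] twisted_shift_diff[symmetric] norm_T_shift .
  then show "(\<lambda>n. T (twisted_shift l z (L1 (bump n))) (T f u)) \<longlonglongrightarrow> T (twisted_shift l z f) u"
    by (simp add: tendsto_norm_zero_iff Lim_null[symmetric])
qed

lemma rep_zero: "u \<in> essential \<Longrightarrow> rep 0 u = u"
  by (rule rep_eqI) (simp_all add: essential_lim)

lemma tendsto_rep:
  assumes u: "u \<in> essential" and s: "\<And>n. s n \<in> essential" and lim: "s \<longlonglongrightarrow> u"
  shows "(\<lambda>n. rep z (s n)) \<longlonglongrightarrow> rep z u"
proof -
  have "(\<lambda>n. norm (s n - u)) \<longlonglongrightarrow> 0" using lim by (simp add: tendsto_norm_zero_iff Lim_null[symmetric])
  moreover have "norm (rep z (s n) - rep z u) = norm (s n - u)" for n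
    using u s norm_rep[of "s n - u" z] closed_csubspace_essential by (simp add: rep_diff diff_closed_csubspace)
  ultimately have "(\<lambda>n. norm (rep z (s n) - rep z u)) \<longlonglongrightarrow> 0" by (simp only:)
  then show ?thesis by (rule LIM_zero_cancel[OF tendsto_norm_zero_cancel])
qed

lemma rep_rep:
  assumes u: "u \<in> essential"
  shows "rep z (rep w u) = twist l z w *\<^sub>C rep (z + w) u"
proof (rule LIMSEQ_unique)
  show "(\<lambda>n. rep z (T (twisted_shift l w (L1 (bump n))) u)) \<longlonglongrightarrow> rep z (rep w u)"
    by (intro tendsto_rep rep_in_essential rep_lim u T_in_essential)
  show "(\<lambda>n. rep z (T (twisted_shift l w (L1 (bump n))) u)) \<longlonglongrightarrow> twist l z w *\<^sub>C rep (z + w) u"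
    unfolding rep_T twisted_shift_twisted_shift T_scaleC scaleC_blinfun.rep_eq
    by (intro tendsto_scaleC tendsto_const rep_lim u)
qed

text \<open>The functions \<open>z \<mapsto> T (L\<^sub>z (bump n)) u\<close> are continuous, and they converge uniformly in \<open>z\<close> since
  \<open>rep z\<close> is an isometry that maps \<open>T (bump n) u - u\<close> to the error.\<close>

lemma continuous_on_rep:
  assumes u: "u \<in> essential"
  shows "continuous_on UNIV (\<lambda>z. rep z u)"
proof (rule uniform_limit_theorem)
  show "\<forall>\<^sub>F n in sequentially. continuous_on UNIV (\<lambda>z. T (twisted_shift l z (L1 (bump n))) u)"
    using bounded_linear.continuous_on[OF bounded_linear_T continuous_on_twisted_shift]
    by (intro always_eventually allI continuous_intros)
  show "uniform_limit UNIV (\<lambda>n z. T (twisted_shift l z (L1 (bump n))) u) (\<lambda>z. rep z u) sequentially"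
  proof (rule uniform_limitI)
    fix e :: real assume "0 < e"
    have eq: "dist (T (twisted_shift l z f) u) (rep z u) = dist (T f u) u" for z f
      using norm_rep[of "T f u - u" z] u closed_csubspace_essential
      by (simp add: dist_norm rep_T[symmetric] rep_diff T_in_essential diff_closed_csubspace)
    from tendstoD[OF essential_lim[OF u] \<open>0 < e\<close>]
    show "\<forall>\<^sub>F n in sequentially. \<forall>z\<in>UNIV. dist (T (twisted_shift l z (L1 (bump n))) u) (rep z u) < e"
      unfolding eq by simp
  qed
qed simp

lemma integrable_cinner_rep:
  assumes u: "u \<in> essential" and f: "integrable lborel f"
  shows "integrable lborel (\<lambda>z. f z * cinner (rep z u) v)"
proof (rule Bochner_Integration.integrable_bound)
  have "(\<lambda>z. cinner (rep z u) v) \<in> borel_measurable borel"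
    by (intro borel_measurable_continuous_onI continuous_on_cinner continuous_on_rep u continuous_on_const)
  then show "(\<lambda>z. f z * cinner (rep z u) v) \<in> borel_measurable lborel"
    using borel_measurable_integrable[OF f] by measurable
  show "integrable lborel (\<lambda>z. (norm u * norm v) * cmod (f z))" using f by simp
  show "AE z in lborel. norm (f z * cinner (rep z u) v) \<le> norm ((norm u * norm v) * cmod (f z))"
  proof (rule AE_I2)
    fix z
    from mult_left_mono[OF norm_cinner_le[of "rep z u" v] norm_ge_zero[of "f z"]]
    show "norm (f z * cinner (rep z u) v) \<le> norm ((norm u * norm v) * cmod (f z))"
      by (simp add: norm_mult norm_rep u abs_mult mult_ac)
  qed
qed

text \<open>For \<open>h\<close> concentrated near \<open>a\<close>, replace \<open>u\<close> by \<open>T g u\<close> with \<open>g\<close> a late bump function.  Then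
  \<open>T h (T g u) = T (h * g) u\<close> is close to \<open>(\<integral> h) T (L\<^sub>a g) u\<close>, which is close to
  \<open>(\<integral> h) rep a u\<close>.\<close>

lemma cinner_T_eq_integral:
  assumes u: "u \<in> essential" and f: "integrable lborel f"
  shows "cinner (T (L1 f) u) v = (\<integral>z. f z * cinner (rep z u) v \<partial>lborel)"
proof (rule L1_functional_eq_integral[where \<phi> = "\<lambda>f. cinner (T f u) v" and m = "\<lambda>z. cinner (rep z u) v"
      and C = "onorm T * norm u * norm v" and B = "norm u * norm v", OF _ _ _ _ _ f])
  show "cinner (T (f + g) u) v = cinner (T f u) v + cinner (T g u) v" for f g
    by (simp add: T_add blinfun.add_left cinner_add_left)
  show "cmod (cinner (T f u) v) \<le> onorm T * norm u * norm v * norm f" for f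
    using norm_cinner_le[of "T f u" v] mult_right_mono[OF norm_T_apply_le[of f u] norm_ge_zero[of v]]
    by (simp add: mult_ac)
  show "continuous_on UNIV (\<lambda>z. cinner (rep z u) v)"
    by (intro continuous_on_cinner continuous_on_rep u continuous_on_const)
  show "cmod (cinner (rep z u) v) \<le> norm u * norm v" for z
    using norm_cinner_le[of "rep z u" v] by (simp add: norm_rep u)
next
  fix a :: "complex ^ 'n" and e :: real assume e: "0 < e"
  define K where "K = onorm T"
  have K: "0 \<le> K" unfolding K_def by (rule onorm_T_nonneg)
  \<comment> \<open>The three errors of the approximation, with tolerance \<open>d\<close> each, add up to at most \<open>(M - 1) d\<close>
    times the norm of \<open>h\<close>.\<close>
  define M where "M = (K + K * norm u + 1) * norm v + 1"
  have M: "0 < M" unfolding M_def using K by (intro add_nonneg_pos mult_nonneg_nonneg add_nonneg_nonneg) auto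
  define d where "d = e / M"
  have d: "0 < d" using e M by (simp add: d_def)
  obtain n where n: "norm (T (L1 (bump n)) u - u) < d"
    using LIMSEQ_D[OF essential_lim[OF u] d] by blast
  define g where "g = (L1 (bump n) :: (complex ^ 'n) L1)"
  define U where "U = (\<lambda>z. twisted_shift l z g) -` ball (twisted_shift l a g) d"
  have "open U" unfolding U_def by (intro open_vimage continuous_on_twisted_shift) simp
  moreover have "a \<in> U" using d by (simp add: U_def)
  moreover have "cmod (cinner (T (L1 h) u) v - cinner (rep a u) v * (\<integral>z. h z \<partial>lborel)) \<le> e * norm (L1 h)"
    if h: "integrable lborel h" and hU: "\<And>z. h z \<noteq> 0 \<Longrightarrow> z \<in> U" for h
  proof -
    define I where "I = (\<integral>z. h z \<partial>lborel)"
    define N where "N = norm (L1 h)"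
    have I: "cmod I \<le> N" unfolding I_def N_def norm_L1[OF h] by (rule integral_norm_bound)
    have N: "0 \<le> N" by (simp add: N_def)
    have "norm (twisted_conv l (L1 h) g - I *\<^sub>C twisted_shift l a g) \<le> d * N"
      unfolding I_def N_def
      by (rule norm_twisted_conv_minus_shift_le[OF h])
        (use hU in \<open>fastforce simp: U_def dist_norm norm_minus_commute\<close>)
    then have 2: "norm (T (twisted_conv l (L1 h) g - I *\<^sub>C twisted_shift l a g) u) \<le> K * (d * N) * norm u"
      using norm_T_apply_le[of _ u] K unfolding K_def
      by (meson mult_left_mono mult_right_mono norm_ge_zero order_trans)
    have "norm (T (L1 h) (u - T g u)) \<le> K * N * norm (u - T g u)"
      unfolding K_def N_def by (rule norm_T_apply_le)
    also have "\<dots> \<le> K * N * d"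
      using n K N by (intro mult_left_mono mult_nonneg_nonneg) (auto simp: g_def norm_minus_commute)
    finally have 1: "norm (T (L1 h) (u - T g u)) \<le> K * N * d" .
    have "norm (T (twisted_shift l a g) u - rep a u) < d"
      using n norm_rep[of "T g u - u" a] u closed_csubspace_essential
      by (simp add: rep_T[symmetric] rep_diff T_in_essential diff_closed_csubspace g_def)
    then have 3: "norm (I *\<^sub>C (T (twisted_shift l a g) u - rep a u)) \<le> N * d"
      unfolding norm_scaleC using I N by (intro mult_mono) auto
    have "T (L1 h) u - I *\<^sub>C rep a u = T (L1 h) (u - T g u)
        + (T (twisted_conv l (L1 h) g - I *\<^sub>C twisted_shift l a g) u + I *\<^sub>C (T (twisted_shift l a g) u - rep a u))"
      using scaleC_add_right[of I "T (twisted_shift l a g) u - rep a u" "rep a u"]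
      by (simp add: blinfun.diff_right T_diff blinfun.diff_left T_conv_apply T_scaleC scaleC_blinfun.rep_eq algebra_simps)
    then have "norm (T (L1 h) u - I *\<^sub>C rep a u) \<le> K * N * d + (K * (d * N) * norm u + N * d)"
      using 1 2 3 by (metis (no_types, lifting) add_mono norm_triangle_le)
    also have "\<dots> = (K + K * norm u + 1) * (d * N)" by (simp add: algebra_simps)
    finally have "norm (T (L1 h) u - I *\<^sub>C rep a u) * norm v \<le> (K + K * norm u + 1) * (d * N) * norm v"
      by (rule mult_right_mono) simp
    also have "\<dots> = (M - 1) * (d * N)" by (simp add: M_def algebra_simps)
    also have "\<dots> \<le> M * (d * N)" using d N by (intro mult_right_mono) auto
    also have "\<dots> = e * N" using M by (simp add: d_def)
    finally have "cmod (cinner (T (L1 h) u - I *\<^sub>C rep a u) v) \<le> e * N"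
      using norm_cinner_le order_trans by blast
    then show ?thesis
      by (simp add: cinner_diff_left cinner_scaleC_left I_def N_def mult.commute)
  qed
  ultimately show "\<exists>U. open U \<and> a \<in> U \<and> (\<forall>h. integrable lborel h \<longrightarrow> (\<forall>z. h z \<noteq> 0 \<longrightarrow> z \<in> U) \<longrightarrow>
      cmod (cinner (T (L1 h) u) v - cinner (rep a u) v * (\<integral>z. h z \<partial>lborel)) \<le> e * norm (L1 h))"
    by blast
qed

definition heis_rep :: "(complex ^ 'n) \<times> real \<Rightarrow> 'h \<Rightarrow> 'h" where
  "heis_rep p u = exp (\<i> * complex_of_real (l * snd p)) *\<^sub>C rep (fst p) u"

lemma unitary_on_heis_rep: "unitary_on essential (heis_rep p)"
  unfolding unitary_on_def
proof (intro conjI ballI allI)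
  define c where "c = exp (\<i> * complex_of_real (l * snd p))"
  have c: "cmod c = 1" "cnj c * c = 1" "c * cnj c = 1"
    using complex_norm_square[of c] by (simp_all add: c_def mult.commute)
  fix u assume u: "u \<in> essential"
  show "heis_rep p (u + v) = heis_rep p u + heis_rep p v" if "v \<in> essential" for v
    by (simp add: heis_rep_def rep_add u that scaleC_add_right)
  show "cinner (heis_rep p u) (heis_rep p v) = cinner u v" if "v \<in> essential" for v
    unfolding heis_rep_def c_def[symmetric] using c
    by (simp add: cinner_scaleC_left cinner_scaleC_right cinner_rep u that mult.assoc[symmetric])
  show "heis_rep p (a *\<^sub>C u) = a *\<^sub>C heis_rep p u" for a
    by (simp add: heis_rep_def rep_scaleC u scaleC_scaleC mult.commute)
next
  define c where "c = exp (\<i> * complex_of_real (l * snd p))"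
  have c: "c * cnj c = 1"
    using complex_norm_square[of c] by (simp add: c_def)
  have sc: "a *\<^sub>C u \<in> essential" if "u \<in> essential" for a u
    using closed_csubspace_essential that by (simp add: closed_csubspace_def)
  show "heis_rep p ` essential = essential"
  proof
    show "heis_rep p ` essential \<subseteq> essential"
      by (auto simp: heis_rep_def intro!: sc rep_in_essential)
    show "essential \<subseteq> heis_rep p ` essential"
    proof
      fix u assume u: "u \<in> essential"
      have "rep (fst p) (rep (- fst p) u) = u"
        by (simp add: rep_rep u twist_minus_right rep_zero)
      then have "heis_rep p (cnj c *\<^sub>C rep (- fst p) u) = u"
        unfolding heis_rep_def c_def[symmetric] by (simp add: rep_scaleC rep_in_essential u scaleC_scaleC c)
      then show "u \<in> heis_rep p ` essential"
        using sc[OF rep_in_essential[OF u]] by (metis image_eqI)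
    qed
  qed
qed

lemma unitary_representation_heis_rep: "unitary_representation heisenberg essential heis_rep"
  unfolding unitary_representation_def
proof (intro conjI ballI)
  show "closed_csubspace essential" by (rule closed_csubspace_essential)
  show "unitary_on essential (heis_rep p)" for p by (rule unitary_on_heis_rep)
  show "heis_rep (p \<otimes>\<^bsub>heisenberg\<^esub> q) u = heis_rep p (heis_rep q u)" if u: "u \<in> essential" for p q u
  proof -
    obtain z t w s where pq: "p = (z, t)" "q = (w, s)" by (metis surj_pair)
    have "exp (\<i> * complex_of_real (l * (t + s + 1/2 * Im (hdot z w))))
        = exp (\<i> * complex_of_real (l * t)) * (exp (\<i> * complex_of_real (l * s)) * twist l z w)"
      unfolding twist_def exp_add[symmetric] by (simp add: algebra_simps)
    then show ?thesis
      by (simp add: pq heis_rep_def heisenberg_def rep_scaleC rep_in_essential u rep_rep scaleC_scaleC mult.assoc)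
  qed
  show "continuous_on (carrier heisenberg) (\<lambda>p. heis_rep p u)" if u: "u \<in> essential" for u
  proof -
    have "continuous_on UNIV (\<lambda>p::(complex ^ 'n) \<times> real. rep (fst p) u)"
      by (rule continuous_on_compose2[OF continuous_on_rep[OF u]]) (auto intro: continuous_intros)
    then have "continuous_on UNIV (\<lambda>p. heis_rep p u)"
      unfolding heis_rep_def by (intro continuous_on_scaleC continuous_intros)
    then show ?thesis by (rule continuous_on_subset) simp
  qed
qed

lemma has_weak_operator_integral_T:
  "has_weak_operator_integral lborel essential (\<lambda>z v. rep_L1 f z *\<^sub>C heis_rep (z, 0) v) (T f)"
  unfolding has_weak_operator_integral_def
proof (intro conjI ballI)
  show "T f u \<in> essential" for u by (rule T_in_essential)
  fix u v assume u: "u \<in> essential"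
  show "has_bochner_integral lborel (\<lambda>z. cinner (rep_L1 f z *\<^sub>C heis_rep (z, 0) u) v) (cinner (T f u) v)"
    using integrable_cinner_rep[OF u integrable_rep_L1, of f v] cinner_T_eq_integral[OF u integrable_rep_L1, of f v]
    by (simp add: has_bochner_integral_iff heis_rep_def cinner_scaleC_left L1_rep_L1)
qed

text \<open>The null space is the orthogonal complement of the essential subspace: if \<open>y\<close> is orthogonal to all
  \<open>T g v\<close>, then \<open>\<parallel>T f y\<parallel>\<^sup>2 = \<langle>y, T f\<^sup>* (T f y)\<rangle> = 0\<close>.\<close>

lemma orthogonal_direct_sum_essential: "orthogonal_direct_sum essential {v. \<forall>f. T f v = 0}"
  unfolding orthogonal_direct_sum_def
proof (intro conjI ballI allI)
  show "closed_csubspace essential" by (rule closed_csubspace_essential)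
  have "closed {v. T f v = 0}" for f
    by (intro closed_Collect_eq continuous_intros)
  then have "closed {v. \<forall>f. T f v = 0}" by (rule closed_Collect_all)
  moreover have "a *\<^sub>C 0 = (0::'h)" for a using scaleC_add_right[of a 0 "0::'h"] by simp
  ultimately show "closed_csubspace {v. \<forall>f. T f v = 0}"
    by (simp add: closed_csubspace_def blinfun.add_right T_apply_scaleC)
  show "cinner u v = 0" if u: "u \<in> essential" and v: "v \<in> {v. \<forall>f. T f v = 0}" for u v
  proof (rule LIMSEQ_unique)
    show "(\<lambda>n. cinner (T (L1 (bump n)) u) v) \<longlonglongrightarrow> cinner u v"
      by (intro tendsto_cinner essential_lim u tendsto_const)
    have "cinner u (0::'h) = 0" using cinner_diff_right[of u 0 0] by simp
    then show "(\<lambda>n. cinner (T (L1 (bump n)) u) v) \<longlonglongrightarrow> 0"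
      using v by (simp add: cinner_T)
  qed
  fix u
  obtain x y where x: "x \<in> essential" and u: "u = x + y" and y: "\<And>w. w \<in> essential \<Longrightarrow> cinner w y = 0"
    using exists_orthogonal_decomposition[OF closed_csubspace_essential] by blast
  have "T f y = 0" for f
  proof -
    have "cinner (T f y) (T f y) = cinner y (T (L1_star f) (T f y))" by (rule cinner_T)
    also have "\<dots> = cnj (cinner (T (L1_star f) (T f y)) y)" by (rule cinner_commute)
    finally show ?thesis by (simp add: y T_in_essential cinner_self)
  qed
  then show "\<exists>x\<in>essential. \<exists>y\<in>{v. \<forall>f. T f v = 0}. u = x + y" using x u by blast
qed

end

section \<open>The integrated form of the homomorphism\<close>

theorem theorem3p1:
  fixes l :: real
    and T :: "(complex ^ 'n) L1 \<Rightarrow> (real ^ 'n) L2 \<Rightarrow>\<^sub>L (real ^ 'n) L2"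
  assumes "l \<noteq> 0"
    and "\<And>f. T f \<in> bounded_operators"
    and "clinear_map T"
    and "continuous_on UNIV T"
    and "\<exists>f. T f \<noteq> 0"
    and "\<And>f g. T (twisted_conv l f g) = T f o\<^sub>L T g"
    and "\<And>f. is_adjoint (T (L1_star f)) (T f)"
  shows "\<exists>H \<rho>.
    unitary_representation (heisenberg :: ((complex ^ 'n) \<times> real) monoid) H \<rho> \<and>
    (\<forall>f. has_weak_operator_integral lborel H (\<lambda>z v. rep_L1 f z *\<^sub>C \<rho> (z, 0) v) (T f)) \<and>
    orthogonal_direct_sum H {v. \<forall>f. T f v = 0}"
proof -
  interpret twisted_star_hom l T
    by unfold_locales (use assms in auto)
  show ?thesis
    using unitary_representation_heis_rep has_weak_operator_integral_T orthogonal_direct_sum_essential by blast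
qed

end
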